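(* Let $g\in W^{1,1}(\mathbb{R})$ be an even averaging kernel with $\int_{\mathbb{R}} g=1$. Consider the system $$v^+_t+(\bar u+\bar a)\,v^+_x=0,\qquad v^-_t+(\bar u-\bar a)\,v^-_x=0,\qquad \bar u=g*u,\quad \bar a=g*a,$$ with Riemann initial data $$u(x,0)=\begin{cases}u_l & x<0\\ u_r & x\ge 0\end{cases},\qquad a(x,0)=\begin{cases}a_l & x<0\\ a_r & x\ge 0\end{cases},$$ where $a_l,a_r>0$, and put $v^\pm_l=u_l\pm\frac{2a_l}{\gamma-1}$, $v^\pm_r=u_r\pm\frac{2a_r}{\gamma-1}$. Let $x^\pm(t)$ be the locations of the discontinuities of $v^\pm$, so that $x^\pm(0)=0$ and $\frac{d}{dt}x^\pm=\bar u(x^\pm,t)\pm\bar a(x^\pm,t)$. Then, for $t>0$, $x^-(t)<x^+(t)$ and the solution is $$v^+(x,t)=\begin{cases}v^+_l & x<x^+(t)\\ v^+_r & x^+(t)\le x\end{cases},\qquad v^-(x,t)=\begin{cases}v^-_l & x<x^-(t)\\ v^-_r & x^-(t)\le x\end{cases},$$ equivalently $$u(x,t)=\begin{cases}u_l & x<x^-(t)\\ u_m & x^-(t)\le x<x^+(t)\\ u_r & x^+(t)\le x\end{cases},\qquad a(x,t)=\begin{cases}a_l & x<x^-(t)\\ a_m & x^-(t)\le x<x^+(t)\\ a_r & x^+(t)\le x\end{cases},$$ where $u_m=\frac{v^+_l+v^-_r}{2}$ and $a_m=\frac{\gamma-1}{2}\cdot\frac{v^+_l-v^-_r}{2}$.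
   Context: Here $x\in\mathbb{R}$, $t\ge 0$, $u$ is the fluid velocity, $a$ the speed of sound, $\gamma>0$, $\gamma\neq 1$ a fixed real constant, and $v^{\pm}=u\pm\frac{2a}{\gamma-1}$, so $u=\frac{v^++v^-}{2}$ and $a=\frac{\gamma-1}{4}(v^+-v^-)$. The convolution is in the space variable: $(g*f)(x,t)=\int_{\mathbb{R}} g(x-y)f(y,t)\,dy$. Sense of solution: for bounded initial data $v^\pm_0$, the solution is given by $v^\pm(x,t)=v_0^\pm(\varphi^\pm(x,t))$, where for each $t$ the map $x\mapsto\varphi^\pm(x,t)$ is the continuously differentiable inverse of $\xi\mapsto\phi^\pm(\xi,t)$, and $\frac{\partial}{\partial t}\phi^\pm(\xi,t)=\bar u(\phi^\pm(\xi,t),t)\pm\bar a(\phi^\pm(\xi,t),t)$, $\phi^\pm(\xi,0)=\xi$. *)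

theory Defs
  imports "HOL-Analysis.Analysis"
begin

definition test_function :: "(real \<Rightarrow> real) \<Rightarrow> bool" where
  "test_function \<psi> \<longleftrightarrow>
     (\<forall>n. (deriv ^^ n) \<psi> differentiable_on UNIV) \<and> compact (closure {x. \<psi> x \<noteq> 0})"

definition weak_derivative :: "(real \<Rightarrow> real) \<Rightarrow> (real \<Rightarrow> real) \<Rightarrow> bool" where
  "weak_derivative f h \<longleftrightarrow>
     (\<forall>\<psi>. test_function \<psi> \<longrightarrow>
        (LINT x|lborel. f x * deriv \<psi> x) = - (LINT x|lborel. h x * \<psi> x))"

definition sobolev_W11 :: "(real \<Rightarrow> real) \<Rightarrow> bool" where
  "sobolev_W11 f \<longleftrightarrow>
     integrable lborel f \<and> (\<exists>h. integrable lborel h \<and> weak_derivative f h)"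

text \<open>Functions of space and time are curried, space first; only times \<open>t \<ge> 0\<close> matter.\<close>

definition space_conv :: "(real \<Rightarrow> real) \<Rightarrow> (real \<Rightarrow> real \<Rightarrow> real) \<Rightarrow> real \<Rightarrow> real \<Rightarrow> real" where
  "space_conv g f x t = (LINT y|lborel. g (x - y) * f y t)"

definition inv_plus :: "real \<Rightarrow> real \<Rightarrow> real \<Rightarrow> real" where
  "inv_plus \<gamma> u a = u + 2 * a / (\<gamma> - 1)"

definition inv_minus :: "real \<Rightarrow> real \<Rightarrow> real \<Rightarrow> real" where
  "inv_minus \<gamma> u a = u - 2 * a / (\<gamma> - 1)"

definition fluid_velocity ::
    "(real \<Rightarrow> real \<Rightarrow> real) \<Rightarrow> (real \<Rightarrow> real \<Rightarrow> real) \<Rightarrow> real \<Rightarrow> real \<Rightarrow> real" where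
  "fluid_velocity vp vm x t = (vp x t + vm x t) / 2"

definition sound_speed ::
    "real \<Rightarrow> (real \<Rightarrow> real \<Rightarrow> real) \<Rightarrow> (real \<Rightarrow> real \<Rightarrow> real) \<Rightarrow> real \<Rightarrow> real \<Rightarrow> real" where
  "sound_speed \<gamma> vp vm x t = (\<gamma> - 1) / 4 * (vp x t - vm x t)"

definition speed_plus :: "real \<Rightarrow> (real \<Rightarrow> real) \<Rightarrow>
    (real \<Rightarrow> real \<Rightarrow> real) \<Rightarrow> (real \<Rightarrow> real \<Rightarrow> real) \<Rightarrow> real \<Rightarrow> real \<Rightarrow> real" where
  "speed_plus \<gamma> g vp vm x t =
     space_conv g (fluid_velocity vp vm) x t + space_conv g (sound_speed \<gamma> vp vm) x t"

definition speed_minus :: "real \<Rightarrow> (real \<Rightarrow> real) \<Rightarrow>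
    (real \<Rightarrow> real \<Rightarrow> real) \<Rightarrow> (real \<Rightarrow> real \<Rightarrow> real) \<Rightarrow> real \<Rightarrow> real \<Rightarrow> real" where
  "speed_minus \<gamma> g vp vm x t =
     space_conv g (fluid_velocity vp vm) x t - space_conv g (sound_speed \<gamma> vp vm) x t"

text \<open>The derivative is taken within \<open>{0..}\<close>, hence one-sided at \<open>t = 0\<close>.\<close>

definition characteristic_curve ::
    "(real \<Rightarrow> real \<Rightarrow> real) \<Rightarrow> real \<Rightarrow> (real \<Rightarrow> real) \<Rightarrow> bool" where
  "characteristic_curve w \<xi> X \<longleftrightarrow>
     X 0 = \<xi> \<and> (\<forall>t\<ge>0. (X has_real_derivative w (X t) t) (at t within {0..}))"

text \<open>Solutions of \<open>v\<^sub>t + w v\<^sub>x = 0\<close>, \<open>v(x,0) = v0(x)\<close> in the sense of characteristics: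
  \<open>\<Phi> \<xi>\<close> is the characteristic issuing from \<open>\<xi>\<close>, and \<open>\<lambda>x. \<phi> x t\<close> is the inverse
  of \<open>\<lambda>\<xi>. \<Phi> \<xi> t\<close>.\<close>

definition transported ::
    "(real \<Rightarrow> real \<Rightarrow> real) \<Rightarrow> (real \<Rightarrow> real) \<Rightarrow> (real \<Rightarrow> real \<Rightarrow> real) \<Rightarrow> bool" where
  "transported w v0 v \<longleftrightarrow>
     (\<exists>\<Phi> \<phi>.
        (\<forall>\<xi>. characteristic_curve w \<xi> (\<Phi> \<xi>)) \<and>
        (\<forall>t\<ge>0. (\<forall>\<xi>. \<phi> (\<Phi> \<xi> t) t = \<xi>) \<and> (\<forall>x. \<Phi> (\<phi> x t) t = x) \<and>
               (\<lambda>x. \<phi> x t) C1_differentiable_on UNIV) \<and>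
        (\<forall>t\<ge>0. \<forall>x. v x t = v0 (\<phi> x t)))"

definition averaged_solution :: "real \<Rightarrow> (real \<Rightarrow> real) \<Rightarrow> (real \<Rightarrow> real) \<Rightarrow> (real \<Rightarrow> real) \<Rightarrow>
    (real \<Rightarrow> real \<Rightarrow> real) \<Rightarrow> (real \<Rightarrow> real \<Rightarrow> real) \<Rightarrow> bool" where
  "averaged_solution \<gamma> g vp0 vm0 vp vm \<longleftrightarrow>
     vp0 \<in> borel_measurable borel \<and> bounded (range vp0) \<and>
     vm0 \<in> borel_measurable borel \<and> bounded (range vm0) \<and>
     transported (speed_plus \<gamma> g vp vm) vp0 vp \<and>
     transported (speed_minus \<gamma> g vp vm) vm0 vm"

definition riemann_data :: "real \<Rightarrow> real \<Rightarrow> real \<Rightarrow> real" where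
  "riemann_data l r x = (if x < 0 then l else r)"

end

theory Submission
  imports Defs "HOL-Computational_Algebra.Polynomial"
begin

text \<open>Characteristics never cross, so each Riemann invariant stays a step function, jumping along the
  characteristic from the origin. Convolving a step with \<open>g\<close> gives the \<open>C\<^sup>1\<close> profile
  \<open>l + (r - l) G(x - x\<^sup>\<plusminus>(t))\<close>, where \<open>G(s) = \<integral>\<^bsub>z \<le> s\<^esub> g\<close>. The gap \<open>d = x\<^sup>+ - x\<^sup>-\<close> therefore solves an
  autonomous equation \<open>d' = F(d)\<close>, \<open>d(0) = 0\<close>, which determines \<open>x\<^sup>\<plusminus>\<close> and hence the solution.
  Since \<open>g\<close> is even, \<open>G(0) = 1/2\<close>, which gives \<open>F(0) = a\<^sub>l + a\<^sub>r > 0\<close>, so \<open>d\<close> can never return to \<open>0\<close>.\<close>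

section \<open>Antiderivatives and the mean value inequality\<close>

text \<open>The speeds are computed from the very solution that they transport, so for an arbitrary
  solution nothing is known about their regularity in advance. Non-crossing must therefore come from
  the solution concept: the maps in \<open>transported\<close> are invertible at every time, and a
  meeting point of two characteristics would be sent back to two initial points. Only after the step
  structure is known do the speeds become explicit. Each is then a combination of the two smoothed
  steps, with weights (1+\<gamma>)/4 and (3-\<gamma>)/4 in one order or the other; at the jumps only
  the gap enters, so the gap equation closes. Existence asks for more than two curves: the solution
  concept requires a C^1 inverse of the whole flow map at every time. Hence global flows and their
  derivative in the initial point are constructed. The kernel has only a weak derivative, known
  through integrals against smooth compactly supported functions. To reach the C^1 regularity of
  \<open>primitive g\<close>, these must approximate piecewise linear functions, and this requires
  one explicit smooth bump.\<close>

lemma antiderivative_from: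
  fixes f :: "real \<Rightarrow> real"
  assumes "continuous_on UNIV f"
  obtains F where "F a = 0" "\<And>x. (F has_real_derivative f x) (at x)"
proof -
  obtain F where F: "\<And>x. (F has_real_derivative f x) (at x)"
    using einterval_antiderivative[of "-\<infinity>" "\<infinity>" f] assms
    by (auto simp: continuous_on_eq_continuous_at has_real_derivative_iff_has_vector_derivative)
  show thesis
    by (rule that[of "\<lambda>x. F x - F a"]) (auto intro!: derivative_eq_intros F)
qed

lemma zero_derivative_imp_eq:
  fixes f :: "real \<Rightarrow> real"
  assumes D: "\<And>x. (f has_real_derivative f' x) (at x)"
    and "\<And>x. a < x \<Longrightarrow> x < b \<Longrightarrow> f' x = 0" and ab: "a \<le> b"
  shows "f b = f a"
proof (cases "a = b")
  case False
  then have "a < b" using ab by simp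
  moreover have "continuous_on {a..b} f"
    by (rule DERIV_continuous_on[OF has_field_derivative_at_within[OF D]])
  moreover have "(f has_real_derivative 0) (at x)" if "a < x" "x < b" for x
    using D[of x] assms(2)[OF that] by simp
  ultimately show ?thesis by (rule DERIV_isconst_end)
qed simp

lemma lipschitz_from_derivative:
  fixes f :: "real \<Rightarrow> real"
  assumes "\<And>x. (f has_real_derivative f' x) (at x)" "\<And>x. \<bar>f' x\<bar> \<le> L"
  shows "\<bar>f x - f y\<bar> \<le> L * \<bar>x - y\<bar>"
  using field_differentiable_bound[of UNIV f f' L x y] assms by (simp add: has_field_derivative_at_within)

section \<open>Smooth functions\<close>

text \<open>The first half of \<open>test_function\<close>, kept apart because the building blocks
  of the test functions are not compactly supported.\<close>

definition smooth :: "(real \<Rightarrow> real) \<Rightarrow> bool" where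
  "smooth f \<longleftrightarrow> (\<forall>n. (deriv ^^ n) f differentiable_on UNIV)"

lemma smooth_antiderivative:
  assumes "smooth f" "\<And>x. (F has_real_derivative f x) (at x)"
  shows "smooth F"
  unfolding smooth_def
proof
  fix n
  have dF: "deriv F = f"
    using assms(2) DERIV_imp_deriv by blast
  show "(deriv ^^ n) F differentiable_on UNIV"
  proof (cases n)
    case 0
    then show ?thesis
      using assms(2) by (auto simp: differentiable_on_def real_differentiable_def)
  next
    case (Suc m)
    then show ?thesis
      using assms(1) dF by (simp add: smooth_def funpow_swap1 flip: funpow.simps(2))
        (metis comp_apply funpow.simps(2) funpow_swap1)
  qed
qed

lemma smooth_deriv_has_derivative:
  assumes "smooth f"
  shows "((deriv ^^ n) f has_real_derivative (deriv ^^ Suc n) f x) (at x)"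
proof -
  have "(deriv ^^ n) f differentiable at x"
    using assms unfolding smooth_def differentiable_on_def by blast
  then show ?thesis
    by (simp only: DERIV_deriv_iff_real_differentiable funpow.simps comp_apply)
qed

lemma smooth_affine:
  assumes "smooth f"
  shows "smooth (\<lambda>x. f (c * x + d))"
proof -
  have eq: "(deriv ^^ n) (\<lambda>x. f (c * x + d)) = (\<lambda>x. c ^ n * (deriv ^^ n) f (c * x + d))" for n
  proof (induction n)
    case (Suc n)
    have "((\<lambda>x. c ^ n * (deriv ^^ n) f (c * x + d)) has_real_derivative
        c ^ Suc n * (deriv ^^ Suc n) f (c * x + d)) (at x)" for x
      by (rule derivative_eq_intros DERIV_chain'[OF _ smooth_deriv_has_derivative[OF assms]] | simp)+
    then show ?case
      using Suc by (auto simp: DERIV_imp_deriv)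
  qed auto
  show ?thesis
    unfolding smooth_def eq differentiable_on_def
  proof (intro allI ballI)
    fix n x
    have "((\<lambda>x. c ^ n * (deriv ^^ n) f (c * x + d)) has_real_derivative
        c ^ Suc n * (deriv ^^ Suc n) f (c * x + d)) (at x)"
      by (rule derivative_eq_intros DERIV_chain'[OF _ smooth_deriv_has_derivative[OF assms]] | simp)+
    then show "(\<lambda>x. c ^ n * (deriv ^^ n) f (c * x + d)) differentiable at x within UNIV"
      by (auto simp: real_differentiable_def)
  qed
qed

lemma smooth_linear_combination:
  assumes "smooth f" "smooth h"
  shows "smooth (\<lambda>x. a * f x + b * h x)"
proof -
  have D: "((\<lambda>x. a * (deriv ^^ n) f x + b * (deriv ^^ n) h x) has_real_derivative
      a * (deriv ^^ Suc n) f x + b * (deriv ^^ Suc n) h x) (at x)" for n x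
    by (rule derivative_eq_intros smooth_deriv_has_derivative assms | simp)+
  have eq: "(deriv ^^ n) (\<lambda>x. a * f x + b * h x) = (\<lambda>x. a * (deriv ^^ n) f x + b * (deriv ^^ n) h x)" for n
  proof (induction n)
    case (Suc n)
    then show ?case
      using D[of n] by (auto simp: DERIV_imp_deriv)
  qed auto
  show ?thesis
    unfolding smooth_def eq differentiable_on_def
    using D real_differentiable_def by blast
qed

section \<open>An explicit smooth bump on the unit interval\<close>

text \<open>The polynomial \<open>p\<close> and the exponent \<open>n\<close> are parameters so that
  the family is closed under differentiation; all orders of smoothness then follow from
  differentiability of every member.\<close>

definition bump :: "real poly \<Rightarrow> nat \<Rightarrow> real \<Rightarrow> real" where
  "bump p n x = (if 0 < x \<and> x < 1
     then poly p x * exp (- 1 / (x * (1 - x))) / (x * (1 - x)) ^ n else 0)"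

text \<open>A single term of the exponential series. With y = 1/q it lets exp(-1/q) absorb any
  negative power of q.\<close>

lemma power_div_fact_le_exp:
  assumes "(0::real) \<le> y"
  shows "y ^ k / fact k \<le> exp y"
proof -
  have "(\<Sum>n\<in>{k}. y ^ n /\<^sub>R fact n) \<le> exp y"
    unfolding exp_def by (rule sum_le_suminf) (use assms summable_exp in auto)
  then show ?thesis
    by (simp add: field_simps)
qed

text \<open>With q = x(1-x), the series term of order n+2 gives exp(-1/q) \<le> (n+2)! q^(n+2). The
  power n cancels the denominator, and the remaining q^2 is the quadratic order that forces a zero
  derivative at the endpoints.\<close>

lemma bump_flat:
  obtains C where "\<And>x x0. \<not> (0 < x0 \<and> x0 < 1) \<Longrightarrow> \<bar>bump p n x\<bar> \<le> C * (x - x0)\<^sup>2"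
proof -
  have "bounded (poly p ` {0..1})"
    by (intro compact_imp_bounded compact_continuous_image continuous_intros) auto
  then obtain B where B: "\<And>x. 0 \<le> x \<Longrightarrow> x \<le> 1 \<Longrightarrow> \<bar>poly p x\<bar> \<le> B"
    unfolding bounded_iff by (metis atLeastAtMost_iff imageI real_norm_def)
  have B0: "0 \<le> B" using B[of 0] by auto
  define K where "K = fact (n + 2) * B"
  have "\<bar>bump p n x\<bar> \<le> K * (x - x0)\<^sup>2" if "\<not> (0 < x0 \<and> x0 < 1)" for x x0
  proof (cases "0 < x \<and> x < 1")
    case True
    define q where "q = x * (1 - x)"
    have q: "0 < q" using True by (simp add: q_def)
    \<comment> \<open>q is at most the distance from x to either endpoint, and \<open>x0\<close>
      lies at or beyond one of them.\<close>
    have qle: "q \<le> \<bar>x - x0\<bar>"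
    proof (cases "x0 \<le> 0")
      case True
      have "q \<le> x" unfolding q_def using \<open>0 < x \<and> x < 1\<close> mult_left_le[of "1-x" x] by auto
      then show ?thesis using True by auto
    next
      case False
      have "q \<le> 1 - x" unfolding q_def using True mult_left_le_one_le[of "1-x" x] by auto
      then show ?thesis using that False by auto
    qed
    define F :: real where "F = fact (n + 2)"
    have F: "0 < F" by (simp add: F_def)
    have "1 / (q ^ n * q\<^sup>2) / F \<le> exp (1 / q)"
      using power_div_fact_le_exp[of "1 / q" "n + 2"] q
      by (simp only: F_def power_add power_one_over) simp
    then have "1 \<le> exp (1 / q) * (F * (q ^ n * q\<^sup>2))"
      using q F by (simp add: field_simps)
    then have "exp (- 1 / q) \<le> F * (q ^ n * q\<^sup>2)"
      by (simp add: exp_minus divide_simps mult.commute)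
    then have "exp (- 1 / q) / q ^ n \<le> F * q\<^sup>2"
      using q by (simp add: divide_le_eq mult_ac)
    then have "\<bar>poly p x\<bar> * (exp (- 1 / q) / q ^ n) \<le> B * (F * q\<^sup>2)"
      using B[of x] True q by (intro mult_mono) auto
    also have "\<dots> \<le> K * (x - x0)\<^sup>2"
      using B0 F power_mono[OF qle, of 2] q unfolding K_def F_def[symmetric] by (simp add: mult_left_mono mult.assoc mult.left_commute)
    finally show ?thesis
      using True q by (simp add: bump_def q_def abs_mult)
  qed (use B0 in \<open>auto simp: bump_def K_def\<close>)
  then show thesis by (rule that)
qed

text \<open>With q = x(1-x), encoded as \<open>[:0, 1, -1:]\<close>, and q' encoded as
  \<open>[:1, -2:]\<close>, the new polynomial is p' q^2 + p q' - n p q' q: the three terms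
  differentiate p, exp(-1/q) and q^(-n) over the common denominator q^(n+2).\<close>

lemma bump_has_derivative:
  "(bump p n has_real_derivative
     bump (pderiv p * [:0, 1, -1:]\<^sup>2 + p * [:1, -2:] - of_nat n * p * [:1, -2:] * [:0, 1, -1:]) (n + 2) x) (at x)"
  (is "(_ has_real_derivative bump ?r _ x) _")
proof (cases "0 < x \<and> x < 1")
  case True
  define q where "q = x * (1 - x)"
  have q: "0 < q" using True by (simp add: q_def)
  have dq: "((\<lambda>x. x * (1 - x)) has_real_derivative 1 - 2 * x) (at x)"
    by (auto intro!: derivative_eq_intros)
  have dE: "((\<lambda>x. exp (- 1 / (x * (1 - x)))) has_real_derivative exp (- 1 / q) * (1 - 2 * x) / q\<^sup>2) (at x)"
  proof (rule DERIV_cong[OF DERIV_fun_exp])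
    show "((\<lambda>x. - 1 / (x * (1 - x))) has_real_derivative (1 - 2 * x) / q\<^sup>2) (at x)"
      by (rule DERIV_cong[OF DERIV_divide[OF DERIV_const dq]])
        (use True in \<open>simp_all add: q_def power2_eq_square\<close>)
  qed (simp add: q_def)
  have dI: "((\<lambda>x. 1 / (x * (1 - x)) ^ n) has_real_derivative - (of_nat n * (1 - 2 * x) / q ^ (n + 1))) (at x)"
  proof (cases n)
    case (Suc m)
    have "((\<lambda>x. 1 / (x * (1 - x)) ^ n) has_real_derivative
        (0 * (x * (1 - x)) ^ n - 1 * (of_nat n * ((1 - 2 * x) * (x * (1 - x)) ^ (n - Suc 0)))) /
        ((x * (1 - x)) ^ n * (x * (1 - x)) ^ n)) (at x)"
      by (intro DERIV_divide DERIV_const DERIV_power dq) (use True in simp)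
    moreover have "(0 * Q - 1 * (k * (l * R))) / (Q * Q) = - (k * l / (Q * q))"
      if "Q = q * R" "R \<noteq> 0" for k l Q R
      using that q by (simp add: field_simps)
    ultimately show ?thesis
      using q Suc unfolding q_def[symmetric] by simp
  qed auto
  have "((\<lambda>x. poly p x * exp (- 1 / (x * (1 - x))) * (1 / (x * (1 - x)) ^ n)) has_real_derivative
      bump ?r (n + 2) x) (at x)"
  proof (rule DERIV_cong[OF DERIV_mult[OF DERIV_mult[OF poly_DERIV dE] dI]])
    have r: "poly ?r x = poly (pderiv p) x * q\<^sup>2 + poly p x * (1 - 2 * x) - of_nat n * poly p x * (1 - 2 * x) * q"
      by (simp add: q_def algebra_simps)
    show "(poly (pderiv p) x * exp (- 1 / (x * (1 - x))) + exp (- 1 / q) * (1 - 2 * x) / q\<^sup>2 * poly p x) *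
        (1 / (x * (1 - x)) ^ n) +
        - (of_nat n * (1 - 2 * x) / q ^ (n + 1)) * (poly p x * exp (- 1 / (x * (1 - x)))) = bump ?r (n + 2) x"
    proof -
      have alg: "(P' * E + E * l / q\<^sup>2 * P) * (1 / Q) + - (m * l / (Q * q)) * (P * E) =
          (P' * q\<^sup>2 + P * l - m * P * l * q) * E / (Q * q\<^sup>2)"
        if "Q \<noteq> 0" for P P' E l m Q :: real
        using that q by (simp add: field_simps power2_eq_square)
      have pw: "q ^ (n + 2) = q ^ n * q\<^sup>2" "q ^ (n + 1) = q ^ n * q"
        by (simp_all only: power_add power_one_right)
      have "q ^ n \<noteq> 0" using q by simp
      then show ?thesis
        unfolding bump_def r using True
        by (simp only: q_def[symmetric] pw if_True simp_thms) (rule alg)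
    qed
  qed
  then show ?thesis
    by (rule has_field_derivative_transform_within_open[of _ _ _ "{0<..<1}"])
      (use True in \<open>auto simp: bump_def\<close>)
next
  \<comment> \<open>At the endpoints and outside, the quadratic bound makes the difference quotient
    O(|y - x|).\<close>
  case False
  obtain C where C: "\<And>y. \<bar>bump p n y\<bar> \<le> C * (y - x)\<^sup>2"
    using bump_flat False by metis
  have "((\<lambda>y. (bump p n y - bump p n x) / (y - x)) \<longlongrightarrow> 0) (at x)"
  proof (rule Lim_null_comparison)
    show "\<forall>\<^sub>F y in at x. norm ((bump p n y - bump p n x) / (y - x)) \<le> C * \<bar>y - x\<bar>"
      unfolding eventually_at_filter
    proof (rule always_eventually, intro allI impI)
      fix y assume "y \<noteq> x"
      moreover have "\<bar>bump p n y - bump p n x\<bar> \<le> C * \<bar>y - x\<bar> * \<bar>y - x\<bar>"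
        using C[of y] C[of x] by (simp add: power2_eq_square mult.assoc)
      ultimately show "norm ((bump p n y - bump p n x) / (y - x)) \<le> C * \<bar>y - x\<bar>"
        by (simp add: divide_le_eq)
    qed
    show "((\<lambda>y. C * \<bar>y - x\<bar>) \<longlongrightarrow> 0) (at x)"
      by (auto intro!: tendsto_eq_intros)
  qed
  then show ?thesis
    using False by (auto simp: has_field_derivative_iff bump_def)
qed

lemma smooth_bump: "smooth (bump p n)"
proof -
  have "\<exists>p' n'. (deriv ^^ k) (bump p n) = bump p' n'" for k
  proof (induction k)
    case (Suc k)
    then show ?case
      using DERIV_imp_deriv[OF bump_has_derivative] by fastforce
  qed auto
  then show ?thesis
    using bump_has_derivative unfolding smooth_def differentiable_on_def real_differentiable_def
    by metis
qed

section \<open>The primitive of a Sobolev kernel\<close>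

lemma smooth_imp_continuous: "smooth f \<Longrightarrow> continuous_on UNIV f"
  using differentiable_imp_continuous_on[of f UNIV] unfolding smooth_def by (auto dest: spec[of _ 0])

text \<open>\<theta> is the normalised antiderivative of the bump, a smooth step from 0 to 1, and
  \<Theta> is its antiderivative. The offset c = 1 - \<Theta>(1) is what the smooth ramp loses
  against x on the transition interval; it vanishes under rescaling.\<close>

lemma smooth_ramp:
  obtains \<Theta> \<theta> :: "real \<Rightarrow> real" and c :: real
  where "smooth \<Theta>" "\<And>x. (\<Theta> has_real_derivative \<theta> x) (at x)" "continuous_on UNIV \<theta>"
    "\<And>x. x \<le> 0 \<Longrightarrow> \<Theta> x = 0" "\<And>x. x \<ge> 1 \<Longrightarrow> \<Theta> x = x - c"
    "\<And>x. x \<le> 0 \<Longrightarrow> \<theta> x = 0" "\<And>x. x \<ge> 1 \<Longrightarrow> \<theta> x = 1"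
    "\<And>x. 0 \<le> \<theta> x" "\<And>x. \<theta> x \<le> 1"
proof -
  let ?b = "bump 1 0"
  have b0: "?b x \<ge> 0" for x by (simp add: bump_def)
  obtain B where B: "B 0 = 0" "\<And>x. (B has_real_derivative ?b x) (at x)"
    using antiderivative_from[OF smooth_imp_continuous[OF smooth_bump]] by metis
  have smooth_B: "smooth B"
    using smooth_antiderivative[OF smooth_bump] B by blast
  have monoB: "B x \<le> B y" if "x \<le> y" for x y
    by (rule DERIV_nonneg_imp_nondecreasing[OF that]) (use B(2) b0 in blast)
  have B_left: "B x = 0" if "x \<le> 0" for x
    using zero_derivative_imp_eq[OF B(2), of x 0] that B(1) by (simp add: bump_def)
  have B_right: "B x = B 1" if "x \<ge> 1" for x
    using zero_derivative_imp_eq[OF B(2), of 1 x] that by (simp add: bump_def)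
  have "B 0 < B 1"
  proof (rule DERIV_pos_imp_increasing_open[of 0 1 B])
    show "\<exists>y. (B has_real_derivative y) (at x) \<and> 0 < y" if "0 < x" "x < 1" for x
      using B(2)[of x] that by (auto simp: bump_def)
    show "continuous_on {0..1} B"
      by (rule DERIV_continuous_on[OF has_field_derivative_at_within[OF B(2)]])
  qed simp
  then have B1: "0 < B 1" using B by simp
  define \<theta> where "\<theta> = (\<lambda>x. B x / B 1)"
  have sm: "smooth \<theta>"
    \<comment> \<open>A scalar multiple, obtained as a linear combination with second coefficient
      0.\<close>
    using smooth_linear_combination[OF smooth_B smooth_B, of "1 / B 1" 0] by (simp add: \<theta>_def)
  obtain \<Theta> where T: "\<Theta> 0 = 0" "\<And>x. (\<Theta> has_real_derivative \<theta> x) (at x)"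
    using antiderivative_from[OF smooth_imp_continuous[OF sm]] by metis
  have \<theta>_left: "\<theta> x = 0" if "x \<le> 0" for x using B_left that by (simp add: \<theta>_def)
  have \<theta>_right: "\<theta> x = 1" if "x \<ge> 1" for x using B_right[OF that] B1 by (simp add: \<theta>_def)
  have T_left: "\<Theta> x = 0" if "x \<le> 0" for x
    using zero_derivative_imp_eq[OF T(2), of x 0] that T(1) \<theta>_left by simp
  have T_right: "\<Theta> x = x - (1 - \<Theta> 1)" if "x \<ge> 1" for x
  proof -
    have D: "((\<lambda>x. \<Theta> x - x) has_real_derivative \<theta> x - 1) (at x)" for x
      by (auto intro!: derivative_eq_intros T)
    show ?thesis
      using zero_derivative_imp_eq[OF D, of 1 x] that \<theta>_right by simp
  qed
  have "\<theta> x \<ge> 0" "\<theta> x \<le> 1" for x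
  proof -
    have "0 \<le> B x" "B x \<le> B 1"
      using monoB[of 0 x] monoB[of x 1] B_left[of x] B_right[of x] B B1 by linarith+
    then show "\<theta> x \<ge> 0" "\<theta> x \<le> 1" using B1 by (auto simp: \<theta>_def)
  qed
  then show thesis
    using that[of \<Theta> \<theta> "1 - \<Theta> 1"] smooth_antiderivative[OF sm T(2)] T T_left T_right
      smooth_imp_continuous[OF sm] \<theta>_left \<theta>_right by blast
qed

section \<open>Testing the weak derivative against ramps\<close>

definition ramp :: "real \<Rightarrow> real" where
  "ramp z = max 0 z"

text \<open>The derivative of \<open>ramp\<close> away from 0. The value 0 at 0 agrees with
  \<theta>(0) = 0, so the rescaled \<theta> converge to it at every point.\<close>

definition step :: "real \<Rightarrow> real" where
  "step z = indicator {0<..} z"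

lemma ramp_diff_le: "\<bar>ramp x - ramp y\<bar> \<le> \<bar>x - y\<bar>"
  by (auto simp: ramp_def)

lemma step_measurable [measurable]: "step \<in> borel_measurable borel"
  unfolding step_def[abs_def] by measurable

lemma ramp_measurable [measurable]: "ramp \<in> borel_measurable borel"
  unfolding ramp_def[abs_def] by measurable

text \<open>The smooth ramps \<open>\<Theta>(k \<cdot>) / k\<close> tend to \<open>ramp\<close>, so the weak derivative can be tested against a
  piecewise linear function; the four ramps are combined so as to have compact support.\<close>

lemma weak_derivative_ramp:
  assumes g: "integrable lborel g" and h: "integrable lborel h" and w: "weak_derivative g h"
  shows "(LINT y|lborel. g y * (step (y - a) - step (y - a - s) - step (y - b) + step (y - b - s))) =
    - (LINT y|lborel. h y * (ramp (y - a) - ramp (y - a - s) - ramp (y - b) + ramp (y - b - s)))"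
proof -
  obtain \<Theta> \<theta> :: "real \<Rightarrow> real" and c :: real where T: "smooth \<Theta>"
    "\<And>x. (\<Theta> has_real_derivative \<theta> x) (at x)" and cont: "continuous_on UNIV \<theta>"
    and T_left: "\<And>x. x \<le> 0 \<Longrightarrow> \<Theta> x = 0" and T_right: "\<And>x. x \<ge> 1 \<Longrightarrow> \<Theta> x = x - c"
    and \<theta>: "\<And>x. x \<le> 0 \<Longrightarrow> \<theta> x = 0" "\<And>x. x \<ge> 1 \<Longrightarrow> \<theta> x = 1" "\<And>x. 0 \<le> \<theta> x" "\<And>x. \<theta> x \<le> 1"
    using smooth_ramp by blast
  have [measurable]: "g \<in> borel_measurable borel" "h \<in> borel_measurable borel"
    using g h by auto
  have lipT: "\<bar>\<Theta> x - \<Theta> y\<bar> \<le> \<bar>x - y\<bar>" for x y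
    using lipschitz_from_derivative[OF T(2), of 1 x y] \<theta> by auto
  have [measurable]: "\<theta> \<in> borel_measurable borel" "\<Theta> \<in> borel_measurable borel"
    using cont T by (auto intro!: borel_measurable_continuous_onI smooth_imp_continuous)
  \<comment> \<open>The scale is n+1, so that it is positive already for n = 0.\<close>
  define K :: "nat \<Rightarrow> real" where "K n = real (Suc n)" for n
  have K: "K n > 0" for n by (simp add: K_def)
  define TK where "TK n z = \<Theta> (K n * z) / K n" for n z
  have smTK: "smooth (\<lambda>y. TK n (y - z))" for n z
    using smooth_linear_combination[OF smooth_affine[OF T(1), of "K n" "- K n * z"]
        smooth_affine[OF T(1), of "K n" "- K n * z"], of "1 / K n" 0]
    by (simp add: TK_def algebra_simps)
  have dTK: "((\<lambda>y. TK n (y - z)) has_real_derivative \<theta> (K n * (y - z))) (at y)" for n y z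
    unfolding TK_def using K[of n]
    by (auto intro!: derivative_eq_intros DERIV_chain'[OF _ T(2)])
  have lipTK: "\<bar>TK n x - TK n y\<bar> \<le> \<bar>x - y\<bar>" for n x y
    using lipT[of "K n * x" "K n * y"] K[of n]
    unfolding right_diff_distrib[symmetric] abs_mult
    by (simp add: TK_def diff_divide_distrib[symmetric] divide_le_eq mult.commute)
  have TK_left: "TK n z = 0" if "z \<le> 0" for n z
    using that K[of n] by (simp add: TK_def T_left mult_nonneg_nonpos)
  have TK_right: "TK n z = z - c / K n" if "z \<ge> 1" for n z
  proof -
    have "K n * z \<ge> 1 * 1" using that by (intro mult_mono) (auto simp: K_def)
    then show ?thesis using K[of n] by (simp add: TK_def T_right field_simps)
  qed
  have ev_large: "\<forall>\<^sub>F n in sequentially. K n * z \<ge> 1" if "z > 0" for z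
  proof -
    have "filterlim (\<lambda>n. K n * z) at_top sequentially"
      unfolding K_def using that
      by (intro filterlim_at_top_mult_tendsto_pos[OF tendsto_const] filterlim_compose[OF filterlim_real_sequentially filterlim_Suc]) auto
    then show ?thesis by (simp add: filterlim_at_top)
  qed
  have lim_K: "(\<lambda>n. c / K n) \<longlonglongrightarrow> 0"
    unfolding K_def using tendsto_mult_right[OF LIMSEQ_Suc[OF lim_inverse_n], of c]
    by (simp add: field_simps)
  have TK_lim: "(\<lambda>n. TK n z) \<longlonglongrightarrow> ramp z" for z
  proof (cases "z > 0")
    case True
    have "(\<lambda>n. z - c / K n) \<longlonglongrightarrow> z"
      using tendsto_diff[OF tendsto_const lim_K, of z] by simp
    moreover have "\<forall>\<^sub>F n in sequentially. z - c / K n = TK n z"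
      using ev_large[OF True]
      by eventually_elim (use K in \<open>simp add: TK_def T_right field_simps less_imp_neq[symmetric]\<close>)
    ultimately show ?thesis
      using True by (simp add: ramp_def tendsto_cong)
  qed (simp add: TK_left ramp_def)
  have \<theta>_lim: "(\<lambda>n. \<theta> (K n * z)) \<longlonglongrightarrow> step z" for z
  proof (cases "z > 0")
    case True
    have "\<forall>\<^sub>F n in sequentially. \<theta> (K n * z) = 1"
      using ev_large[OF True] by eventually_elim (simp add: \<theta>)
    then show ?thesis
      using True by (simp add: step_def tendsto_eventually)
  qed (use K in \<open>simp add: \<theta> step_def mult_nonneg_nonpos less_imp_le\<close>)
  define \<psi> where "\<psi> n y = TK n (y - a) - TK n (y - a - s) - TK n (y - b) + TK n (y - b - s)" for n y
  define \<psi>' where "\<psi>' n y = \<theta> (K n * (y - a)) - \<theta> (K n * (y - a - s)) - \<theta> (K n * (y - b)) + \<theta> (K n * (y - b - s))" for n y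
  have d\<psi>: "(\<psi> n has_real_derivative \<psi>' n y) (at y)" for n y
    unfolding \<psi>_def \<psi>'_def diff_diff_eq by (intro derivative_intros dTK)
  have "test_function (\<psi> n)" for n
  proof -
    have "smooth (\<lambda>y. 1 * (1 * TK n (y - a) + (-1) * TK n (y - (a + s))) + 1 * ((-1) * TK n (y - b) + 1 * TK n (y - (b + s))))"
      by (intro smooth_linear_combination smTK)
    then have "smooth (\<psi> n)" by (simp add: \<psi>_def[abs_def] diff_diff_eq algebra_simps)
    moreover have "\<psi> n y = 0" if "y \<notin> {- \<bar>a\<bar> - \<bar>b\<bar> - \<bar>s\<bar> .. \<bar>a\<bar> + \<bar>b\<bar> + \<bar>s\<bar> + 1}" for y
    proof (cases "y < 0")
      case True
      then show ?thesis using that by (simp add: \<psi>_def TK_left)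
    next
      case False
      \<comment> \<open>Beyond all four transition intervals the linear parts cancel to s - s and
        the four offsets c / K n cancel as well. This is where the second pair of ramps, at
        \<open>b\<close>, is used to obtain compact support.\<close>
      then have "y - a \<ge> 1" "y - a - s \<ge> 1" "y - b \<ge> 1" "y - b - s \<ge> 1"
        using that by auto
      then show ?thesis by (simp add: \<psi>_def TK_right)
    qed
    then have "{y. \<psi> n y \<noteq> 0} \<subseteq> {- \<bar>a\<bar> - \<bar>b\<bar> - \<bar>s\<bar> .. \<bar>a\<bar> + \<bar>b\<bar> + \<bar>s\<bar> + 1}" by blast
    then have "compact (closure {y. \<psi> n y \<noteq> 0})"
      using bounded_subset[OF bounded_closed_interval] by (subst compact_closure) blast
    ultimately show ?thesis by (simp add: test_function_def smooth_def)
  qed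
  then have eq: "(LINT y|lborel. g y * \<psi>' n y) = - (LINT y|lborel. h y * \<psi> n y)" for n
  proof -
    have "deriv (\<psi> n) = \<psi>' n" using DERIV_imp_deriv[OF d\<psi>, of n] by blast
    then show ?thesis using w \<open>\<And>n. test_function (\<psi> n)\<close> unfolding weak_derivative_def by metis
  qed
  have \<psi>_meas: "\<psi> n \<in> borel_measurable borel" "\<psi>' n \<in> borel_measurable borel" for n
    unfolding \<psi>_def[abs_def] \<psi>'_def[abs_def] TK_def[abs_def] by measurable
  note [measurable] = \<psi>_meas
  have L1: "(\<lambda>n. LINT y|lborel. g y * \<psi>' n y) \<longlonglongrightarrow>
      (LINT y|lborel. g y * (step (y - a) - step (y - a - s) - step (y - b) + step (y - b - s)))"
  proof (rule integral_dominated_convergence[where w = "\<lambda>y. \<bar>g y\<bar> * 2"])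
    show "AE y in lborel. norm (g y * \<psi>' n y) \<le> \<bar>g y\<bar> * 2" for n
    proof (rule AE_I2)
      fix y
      have "\<bar>\<psi>' n y\<bar> \<le> 2"
        using \<theta>(3,4)[of "K n * (y - a)"] \<theta>(3,4)[of "K n * (y - a - s)"] \<theta>(3,4)[of "K n * (y - b)"] \<theta>(3,4)[of "K n * (y - b - s)"]
        by (simp add: \<psi>'_def)
      then show "norm (g y * \<psi>' n y) \<le> \<bar>g y\<bar> * 2" by (simp add: abs_mult mult_left_mono)
    qed
    next
    show "AE y in lborel. (\<lambda>n. g y * \<psi>' n y) \<longlonglongrightarrow>
        g y * (step (y - a) - step (y - a - s) - step (y - b) + step (y - b - s))"
      unfolding \<psi>'_def by (intro AE_I2 tendsto_intros \<theta>_lim)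
  qed (use g in auto)
  have L2: "(\<lambda>n. LINT y|lborel. h y * \<psi> n y) \<longlonglongrightarrow>
      (LINT y|lborel. h y * (ramp (y - a) - ramp (y - a - s) - ramp (y - b) + ramp (y - b - s)))"
  proof (rule integral_dominated_convergence[where w = "\<lambda>y. \<bar>h y\<bar> * (2 * \<bar>s\<bar>)"])
    show "AE y in lborel. norm (h y * \<psi> n y) \<le> \<bar>h y\<bar> * (2 * \<bar>s\<bar>)" for n
    proof (rule AE_I2)
      fix y
      \<comment> \<open>Single ramps are unbounded; ramps whose kinks are s apart differ by at most
        |s|, uniformly in n.\<close>
      have "\<bar>\<psi> n y\<bar> \<le> 2 * \<bar>s\<bar>"
        using lipTK[of n "y - a" "y - a - s"] lipTK[of n "y - b" "y - b - s"]
        by (simp add: \<psi>_def)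
      then show "norm (h y * \<psi> n y) \<le> \<bar>h y\<bar> * (2 * \<bar>s\<bar>)" by (simp add: abs_mult mult_left_mono)
    qed
    next
    show "AE y in lborel. (\<lambda>n. h y * \<psi> n y) \<longlonglongrightarrow>
        h y * (ramp (y - a) - ramp (y - a - s) - ramp (y - b) + ramp (y - b - s))"
      unfolding \<psi>_def by (intro AE_I2 tendsto_intros TK_lim)
  qed (use h in auto)
  show ?thesis
    using LIMSEQ_unique[OF L1] tendsto_minus[OF L2] by (simp add: eq)
qed

section \<open>Regularity of the primitive\<close>

text \<open>Insensitive to changes of \<open>g\<close> on null sets, so it can be C^1 in the
  classical sense even where \<open>g\<close> itself is not continuous.\<close>

definition primitive :: "(real \<Rightarrow> real) \<Rightarrow> real \<Rightarrow> real" where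
  "primitive g s = (LINT z|lborel. g z * indicator {..s} z)"

lemma integrable_indicator_mult:
  fixes f :: "real \<Rightarrow> real"
  assumes "integrable lborel f" "S \<in> sets borel"
  shows "integrable lborel (\<lambda>z. f z * indicator S z)"
  using integrable_real_mult_indicator[of S lborel f] assms by (simp add: mult.commute)

lemma integral_step:
  assumes "integrable lborel g"
  shows "integrable lborel (\<lambda>y. g y * step (y - a))"
    and "(LINT y|lborel. g y * step (y - a)) = (LINT y|lborel. g y) - primitive g a"
proof -
  have eq: "g y * step (y - a) = g y - g y * indicator {..a} y" for y
    by (simp add: step_def indicator_def)
  show "integrable lborel (\<lambda>y. g y * step (y - a))"
    unfolding eq using assms by (intro Bochner_Integration.integrable_diff integrable_indicator_mult) auto
  show "(LINT y|lborel. g y * step (y - a)) = (LINT y|lborel. g y) - primitive g a"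
    unfolding eq primitive_def using assms
    by (intro Bochner_Integration.integral_diff integrable_indicator_mult) auto
qed

lemma abs_primitive_le:
  assumes "integrable lborel g"
  shows "\<bar>primitive g s\<bar> \<le> (LINT z|lborel. \<bar>g z\<bar>)"
proof -
  have "\<bar>primitive g s\<bar> \<le> (LINT z|lborel. \<bar>g z * indicator {..s} z\<bar>)"
    unfolding primitive_def
    using integral_norm_bound[of lborel "\<lambda>z. g z * indicator {..s} z"] by simp
  also have "\<dots> \<le> (LINT z|lborel. \<bar>g z\<bar>)"
    using integrable_indicator_mult[OF assms, of "{..s}"] assms
    by (intro integral_mono integrable_abs) (auto simp: indicator_def)
  finally show ?thesis .
qed

text \<open>The auxiliary pair of kinks at \<open>b\<close> is sent to infinity along b = n. The
  increment of the primitive there vanishes, because both of its terms tend to the total integral;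
  the ramps at \<open>b\<close> drop out by dominated convergence, their difference being bounded by
  |s| independently of b.\<close>

lemma primitive_increment:
  assumes g: "integrable lborel g" and h: "integrable lborel h" and w: "weak_derivative g h"
  shows "primitive g (a + s) - primitive g a = - (LINT y|lborel. h y * (ramp (y - a) - ramp (y - a - s)))"
proof -
  have [measurable]: "g \<in> borel_measurable borel" "h \<in> borel_measurable borel"
    using g h by auto
  have eq: "primitive g (a + s) - primitive g a - (primitive g (b + s) - primitive g b) =
    - (LINT y|lborel. h y * (ramp (y - a) - ramp (y - a - s) - ramp (y - b) + ramp (y - b - s)))" for b
  proof -
    have "(LINT y|lborel. g y * (step (y - a) - step (y - a - s) - step (y - b) + step (y - b - s))) =
      primitive g (a + s) - primitive g a - (primitive g (b + s) - primitive g b)"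
      unfolding diff_diff_eq using integral_step[OF g] by (simp add: distrib_left right_diff_distrib)
    then show ?thesis
      using weak_derivative_ramp[OF assms] by simp
  qed
  have lim: "(\<lambda>n. primitive g (real n + x)) \<longlonglongrightarrow> (LINT y|lborel. g y)" for x
    unfolding primitive_def
  proof (rule integral_dominated_convergence[where w = "\<lambda>y. \<bar>g y\<bar>"])
    show "AE y in lborel. (\<lambda>n. g y * indicator {..real n + x} y) \<longlonglongrightarrow> g y"
    proof (rule AE_I2)
      fix y
      have "\<forall>\<^sub>F n in sequentially. y - x \<le> real n"
        using filterlim_real_sequentially by (simp add: filterlim_at_top)
      then have "\<forall>\<^sub>F n in sequentially. g y * indicator {..real n + x} y = g y"
        by eventually_elim auto
      then show "(\<lambda>n. g y * indicator {..real n + x} y) \<longlonglongrightarrow> g y" by (rule tendsto_eventually)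
    qed
  qed (use g in \<open>auto simp: indicator_def\<close>)
  have "(\<lambda>n. LINT y|lborel. h y * (ramp (y - a) - ramp (y - a - s) - ramp (y - real n) + ramp (y - real n - s)))
    \<longlonglongrightarrow> (LINT y|lborel. h y * (ramp (y - a) - ramp (y - a - s)))"
  proof (rule integral_dominated_convergence[where w = "\<lambda>y. \<bar>h y\<bar> * (2 * \<bar>s\<bar>)"])
    show "AE y in lborel. norm (h y * (ramp (y - a) - ramp (y - a - s) - ramp (y - real n) + ramp (y - real n - s)))
        \<le> \<bar>h y\<bar> * (2 * \<bar>s\<bar>)" for n
    proof (rule AE_I2)
      fix y
      have "\<bar>ramp (y - a) - ramp (y - a - s) - ramp (y - real n) + ramp (y - real n - s)\<bar> \<le> 2 * \<bar>s\<bar>"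
        using ramp_diff_le[of "y - a" "y - a - s"] ramp_diff_le[of "y - real n" "y - real n - s"] by simp
      then show "norm (h y * (ramp (y - a) - ramp (y - a - s) - ramp (y - real n) + ramp (y - real n - s)))
        \<le> \<bar>h y\<bar> * (2 * \<bar>s\<bar>)" by (simp add: abs_mult mult_left_mono)
    qed
    show "AE y in lborel. (\<lambda>n. h y * (ramp (y - a) - ramp (y - a - s) - ramp (y - real n) + ramp (y - real n - s)))
        \<longlonglongrightarrow> h y * (ramp (y - a) - ramp (y - a - s))"
    proof (rule AE_I2)
      fix y
      have "\<forall>\<^sub>F n in sequentially. y + \<bar>s\<bar> \<le> real n"
        using filterlim_real_sequentially by (simp add: filterlim_at_top)
      then have "\<forall>\<^sub>F n in sequentially. h y * (ramp (y - a) - ramp (y - a - s) - ramp (y - real n) + ramp (y - real n - s))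
        = h y * (ramp (y - a) - ramp (y - a - s))"
        by eventually_elim (auto simp: ramp_def max_def)
      then show "(\<lambda>n. h y * (ramp (y - a) - ramp (y - a - s) - ramp (y - real n) + ramp (y - real n - s)))
        \<longlonglongrightarrow> h y * (ramp (y - a) - ramp (y - a - s))" by (rule tendsto_eventually)
    qed
  qed (use h in auto)
  from tendsto_minus[OF this]
  have "(\<lambda>n. primitive g (a + s) - primitive g a - (primitive g (real n + s) - primitive g (real n)))
      \<longlonglongrightarrow> - (LINT y|lborel. h y * (ramp (y - a) - ramp (y - a - s)))"
    by (simp only: eq)
  moreover have "(\<lambda>n. primitive g (a + s) - primitive g a - (primitive g (real n + s) - primitive g (real n)))
      \<longlonglongrightarrow> primitive g (a + s) - primitive g a - ((LINT y|lborel. g y) - (LINT y|lborel. g y))"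
    using lim[of 0] by (intro tendsto_intros lim) auto
  ultimately show ?thesis
    using LIMSEQ_unique by fastforce
qed

text \<open>The derivative is minus the integral of the weak derivative \<open>h\<close> over the
  half-line above a, that is, the continuous representative of \<open>g\<close>. It arises from the
  increment formula because difference quotients of \<open>ramp\<close> are bounded by 1 and tend to
  \<open>step\<close>.\<close>

lemma primitive_C1:
  assumes "sobolev_W11 g"
  obtains g' L where "\<And>x. (primitive g has_real_derivative g' x) (at x)"
    "continuous_on UNIV g'" "\<And>x. \<bar>g' x\<bar> \<le> L"
proof -
  obtain h where g: "integrable lborel g" and h: "integrable lborel h" and w: "weak_derivative g h"
    using assms by (auto simp: sobolev_W11_def)
  have [measurable]: "h \<in> borel_measurable borel"
    using h by auto
  define g' where "g' a = - (LINT y|lborel. h y * step (y - a))" for a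
  \<comment> \<open>The tail is written as total integral minus \<open>primitive h a\<close>; each
    contributes one L^1 norm, whence the factor 2.\<close>
  have bound: "\<bar>g' a\<bar> \<le> 2 * (LINT z|lborel. \<bar>h z\<bar>)" for a
    unfolding g'_def integral_step(2)[OF h]
    using abs_primitive_le[OF h, of a] integral_norm_bound[of lborel h]
    unfolding real_norm_def by linarith
  have cont: "continuous_on UNIV g'"
    unfolding continuous_on_eq_continuous_at[OF open_UNIV] continuous_at_sequentially comp_def
  proof (intro ballI allI impI)
    fix a and X :: "nat \<Rightarrow> real"
    assume X: "X \<longlonglongrightarrow> a"
    show "(\<lambda>n. g' (X n)) \<longlonglongrightarrow> g' a"
      unfolding g'_def
    proof (rule tendsto_minus, rule integral_dominated_convergence[where w = "\<lambda>y. \<bar>h y\<bar>"])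
      show "AE y in lborel. (\<lambda>n. h y * step (y - X n)) \<longlonglongrightarrow> h y * step (y - a)"
        using AE_lborel_singleton[of a]
      proof eventually_elim
        case (elim y)
        have "\<forall>\<^sub>F n in sequentially. step (y - X n) = step (y - a)"
        proof (cases "y < a")
          case True
          have "\<forall>\<^sub>F n in sequentially. y < X n" using X True by (rule order_tendstoD)
          then show ?thesis by eventually_elim (use True in \<open>simp add: step_def\<close>)
        next
          case False
          then have "\<forall>\<^sub>F n in sequentially. X n < y" using X elim by (intro order_tendstoD) auto
          then show ?thesis by eventually_elim (use False elim in \<open>simp add: step_def\<close>)
        qed
        then show ?case by (intro tendsto_mult_left tendsto_eventually)
      qed
      show "AE y in lborel. norm (h y * step (y - X n)) \<le> \<bar>h y\<bar>" for n
        by (intro AE_I2) (simp add: step_def indicator_def)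
      show "(\<lambda>y. h y * step (y - a)) \<in> borel_measurable lborel"
        "(\<lambda>y. h y * step (y - X n)) \<in> borel_measurable lborel" for n
        by measurable
      show "integrable lborel (\<lambda>y. \<bar>h y\<bar>)"
        using h by simp
    qed
  qed
  have "(primitive g has_real_derivative g' a) (at a)" for a
    unfolding DERIV_def tendsto_at_iff_sequentially comp_def
  proof (intro allI impI)
    fix X :: "nat \<Rightarrow> real"
    assume X0: "\<forall>i. X i \<in> UNIV - {0}" and X: "X \<longlonglongrightarrow> 0"
    have "(\<lambda>n. LINT y|lborel. h y * ((ramp (y - a) - ramp (y - a - X n)) / X n)) \<longlonglongrightarrow>
        (LINT y|lborel. h y * step (y - a))"
    proof (rule integral_dominated_convergence[where w = "\<lambda>y. \<bar>h y\<bar>"])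
      \<comment> \<open>Off the kink y = a, which is a null set, the quotient equals
        \<open>step (y - a)\<close> as soon as |X n| < |y - a|.\<close>
      show "AE y in lborel. (\<lambda>n. h y * ((ramp (y - a) - ramp (y - a - X n)) / X n)) \<longlonglongrightarrow> h y * step (y - a)"
        using AE_lborel_singleton[of a]
      proof eventually_elim
        case (elim y)
        have "\<forall>\<^sub>F n in sequentially. \<bar>X n\<bar> < \<bar>y - a\<bar>"
          using tendsto_rabs[OF X] elim by (intro order_tendstoD) auto
        then have "\<forall>\<^sub>F n in sequentially. (ramp (y - a) - ramp (y - a - X n)) / X n = step (y - a)"
          by eventually_elim (use X0 in \<open>auto simp: step_def ramp_def max_def abs_if split: if_splits\<close>)
        then show ?case by (intro tendsto_mult_left tendsto_eventually)
      qed
      show "AE y in lborel. norm (h y * ((ramp (y - a) - ramp (y - a - X n)) / X n)) \<le> \<bar>h y\<bar>" for n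
      proof (rule AE_I2)
        fix y
        have "\<bar>(ramp (y - a) - ramp (y - a - X n)) / X n\<bar> \<le> 1"
          using ramp_diff_le[of "y - a" "y - a - X n"] X0 by (simp add: abs_divide divide_le_eq)
        then show "norm (h y * ((ramp (y - a) - ramp (y - a - X n)) / X n)) \<le> \<bar>h y\<bar>"
          unfolding real_norm_def abs_mult by (rule mult_left_le) simp
      qed
    qed (use h in auto)
    from tendsto_minus[OF this]
    show "(\<lambda>n. (primitive g (a + X n) - primitive g a) / X n) \<longlonglongrightarrow> g' a"
      unfolding primitive_increment[OF g h w] g'_def by simp
  qed
  then show thesis
    using that bound cont by blast
qed

text \<open>Reflection exchanges the two half-lines, which overlap only in the null set {0}; the two
  halves of the integral therefore coincide.\<close>

lemma primitive_even:
  assumes "integrable lborel g" "\<And>x. g (- x) = g x"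
  shows "primitive g 0 = (LINT x|lborel. g x) / 2"
proof -
  have "primitive g 0 = (LINT y|lborel. g y * step (y - 0))"
    unfolding primitive_def
  proof (subst lborel_integral_real_affine[of "-1" _ 0])
    show "\<bar>-1\<bar> *\<^sub>R (LINT x|lborel. g (0 + - 1 * x) * indicator {..0} (0 + - 1 * x)) = (LINT y|lborel. g y * step (y - 0))"
    proof simp
      show "(LINT x|lborel. g (- x) * indicator {..0} (- x)) = (LINT x|lborel. g x * step x)"
        by (rule integral_cong_AE)
          (use assms AE_lborel_singleton[of 0] in \<open>auto simp: step_def indicator_def\<close>)
    qed
  qed simp
  then show ?thesis
    using integral_step(2)[OF assms(1), of 0] by simp
qed

text \<open>After z = x - y the right state is seen exactly for z \<le> x - p, closed at the end
  like the half-line in \<open>primitive\<close>.\<close>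

lemma convolution_riemann:
  assumes "integrable lborel g" "(LINT x|lborel. g x) = 1"
  shows "integrable lborel (\<lambda>y. g (x - y) * riemann_data l r (y - p))"
    and "(LINT y|lborel. g (x - y) * riemann_data l r (y - p)) = l + (r - l) * primitive g (x - p)"
proof -
  have eq: "g z * riemann_data l r (x - z - p) = l * g z + (r - l) * (g z * indicator {..x - p} z)" for z
    by (auto simp: riemann_data_def indicator_def algebra_simps)
  have int: "integrable lborel (\<lambda>z. g z * riemann_data l r (x - z - p))"
    unfolding eq using assms by (intro Bochner_Integration.integrable_add Bochner_Integration.integrable_mult_right integrable_indicator_mult) auto
  show "integrable lborel (\<lambda>y. g (x - y) * riemann_data l r (y - p))"
    using lborel_integrable_real_affine[OF int, of "-1" x] by simp
  have "(LINT y|lborel. g (x - y) * riemann_data l r (y - p)) = (LINT z|lborel. g z * riemann_data l r (x - z - p))"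
    by (subst lborel_integral_real_affine[of "-1" _ x]) auto
  also have "\<dots> = l + (r - l) * primitive g (x - p)"
    unfolding eq primitive_def using assms
    by (subst Bochner_Integration.integral_add) (auto intro!: integrable_indicator_mult)
  finally show "(LINT y|lborel. g (x - y) * riemann_data l r (y - p)) = l + (r - l) * primitive g (x - p)" .
qed

section \<open>Flows of bounded scalar fields\<close>

lemma at_within_nonneg: "(t::real) > 0 \<Longrightarrow> at t within {0..} = at t"
  by (rule at_within_nhd[of _ "{0<..}"]) auto

lemma derivative_comparison:
  fixes A B :: "real \<Rightarrow> real"
  assumes "0 \<le> t"
    and A: "\<And>s. s \<ge> 0 \<Longrightarrow> (A has_real_derivative A' s) (at s within {0..})"
    and B: "\<And>s. s \<ge> 0 \<Longrightarrow> (B has_real_derivative B' s) (at s within {0..})"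
    and le: "\<And>s. s \<ge> 0 \<Longrightarrow> s \<le> t \<Longrightarrow> A' s \<le> B' s"
  shows "A t - A 0 \<le> B t - B 0"
proof (cases "t = 0")
  case False
  have D: "((\<lambda>s. A s - B s) has_real_derivative A' s - B' s) (at s within {0..})" if "s \<ge> 0" for s
    using A[OF that] B[OF that] by (rule DERIV_diff)
  have "A t - B t \<le> A 0 - B 0"
  proof (rule DERIV_nonpos_imp_decreasing_open[of 0 t "\<lambda>s. A s - B s"])
    show "continuous_on {0..t} (\<lambda>s. A s - B s)"
      by (rule DERIV_continuous_on) (rule DERIV_subset[OF D], auto)
    show "\<exists>y. ((\<lambda>s. A s - B s) has_real_derivative y) (at s) \<and> y \<le> 0" if "0 < s" "s < t" for s
      using D[of s] le[of s] that by (auto simp: at_within_nonneg)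
  qed (use assms in auto)
  then show ?thesis by simp
qed simp

lemma abs_derivative_comparison:
  fixes A B :: "real \<Rightarrow> real"
  assumes "0 \<le> t"
    and A: "\<And>s. s \<ge> 0 \<Longrightarrow> (A has_real_derivative A' s) (at s within {0..})"
    and B: "\<And>s. s \<ge> 0 \<Longrightarrow> (B has_real_derivative B' s) (at s within {0..})"
    and le: "\<And>s. s \<ge> 0 \<Longrightarrow> s \<le> t \<Longrightarrow> \<bar>A' s\<bar> \<le> B' s"
  shows "\<bar>A t - A 0\<bar> \<le> B t - B 0"
proof -
  have "A t - A 0 \<le> B t - B 0"
    using assms by (intro derivative_comparison[of t A A' B B']) (auto intro: order_trans[OF abs_ge_self])
  moreover have "- A t - - A 0 \<le> B t - B 0"
    using assms by (intro derivative_comparison[of t "\<lambda>s. - A s" "\<lambda>s. - A' s" B B'])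
      (auto intro: order_trans[OF abs_ge_minus_self] DERIV_minus)
  ultimately show ?thesis by linarith
qed

text \<open>The squares D^2 exp(-2Lt) and D^2 exp(2Lt) are monotone in opposite directions; squaring
  avoids differentiating |D|. The lower bound is what keeps distinct trajectories apart.\<close>

lemma gronwall:
  fixes D :: "real \<Rightarrow> real"
  assumes D: "\<And>s. s \<ge> 0 \<Longrightarrow> (D has_real_derivative D' s) (at s within {0..})"
    and le: "\<And>s. s \<ge> 0 \<Longrightarrow> \<bar>D' s\<bar> \<le> L * \<bar>D s\<bar>"
    and t: "t \<ge> 0"
  shows "\<bar>D t\<bar> \<le> exp (L * t) * \<bar>D 0\<bar>" and "exp (- L * t) * \<bar>D 0\<bar> \<le> \<bar>D t\<bar>"
proof -
  have E: "((\<lambda>s. (D s)\<^sup>2 * exp (k * s)) has_real_derivative (2 * (D s * D' s) + k * (D s)\<^sup>2) * exp (k * s)) (at s within {0..})"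
    if "s \<ge> 0" for s k
    by (rule derivative_eq_intros D[OF that] refl | simp add: algebra_simps power2_eq_square)+
  have prod: "\<bar>D s * D' s\<bar> \<le> L * (D s)\<^sup>2" if "s \<ge> 0" for s
    using mult_left_mono[OF le[OF that], of "\<bar>D s\<bar>"]
    by (simp add: abs_mult power2_eq_square mult.left_commute abs_mult_self_eq)
  have "(D t)\<^sup>2 * exp ((- 2 * L) * t) - (D 0)\<^sup>2 * exp ((- 2 * L) * 0) \<le> 0 - 0"
    by (rule derivative_comparison[OF t E, where B = "\<lambda>_. 0" and B' = "\<lambda>_. 0"])
      (use prod in \<open>auto intro!: mult_nonpos_nonneg simp: abs_le_iff\<close>)
  then have "(D t)\<^sup>2 \<le> (exp (L * t) * \<bar>D 0\<bar>)\<^sup>2"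
    by (simp add: power_mult_distrib exp_double[symmetric] exp_minus field_simps)
  then show "\<bar>D t\<bar> \<le> exp (L * t) * \<bar>D 0\<bar>"
    by (simp add: abs_le_square_iff[symmetric])
  have "0 - 0 \<le> (D t)\<^sup>2 * exp ((2 * L) * t) - (D 0)\<^sup>2 * exp ((2 * L) * 0)"
  proof (rule derivative_comparison[OF t _ E, where A = "\<lambda>_. 0" and A' = "\<lambda>_. 0"])
    show "0 \<le> (2 * (D s * D' s) + 2 * L * (D s)\<^sup>2) * exp (2 * L * s)" if "0 \<le> s" for s
      using prod[OF that] by (intro mult_nonneg_nonneg) (auto simp: abs_le_iff)
  qed auto
  then have "(exp (- L * t) * \<bar>D 0\<bar>)\<^sup>2 \<le> (D t)\<^sup>2"
    by (simp add: power_mult_distrib exp_double[symmetric] exp_minus field_simps)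
  then show "exp (- L * t) * \<bar>D 0\<bar> \<le> \<bar>D t\<bar>"
    by (simp add: abs_le_square_iff[symmetric])
qed

lemma characteristic_curve_unique:
  assumes X: "characteristic_curve w \<xi> X" and Y: "characteristic_curve w \<xi> Y"
    and lip: "\<And>x y t. t \<ge> 0 \<Longrightarrow> \<bar>w x t - w y t\<bar> \<le> L * \<bar>x - y\<bar>" and t: "t \<ge> 0"
  shows "X t = Y t"
proof -
  have "\<bar>X t - Y t\<bar> \<le> exp (L * t) * \<bar>X 0 - Y 0\<bar>"
    by (rule gronwall(1)[where D' = "\<lambda>s. w (X s) s - w (Y s) s"])
      (use X Y lip t in \<open>auto simp: characteristic_curve_def intro!: DERIV_diff\<close>)
  then show ?thesis
    using X Y by (simp add: characteristic_curve_def)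
qed

lemma characteristic_curve_cong:
  assumes "characteristic_curve w \<xi> X" "\<And>x t. t \<ge> 0 \<Longrightarrow> w x t = w' x t"
  shows "characteristic_curve w' \<xi> X"
  using assms by (auto simp: characteristic_curve_def)

section \<open>Global existence of characteristics\<close>

text \<open>The bounds uniform in x and t make characteristics exist for all t \<ge> 0; the
  continuous space derivative makes the flow C^1 in its initial point.\<close>

locale scalar_field =
  fixes w w' :: "real \<Rightarrow> real \<Rightarrow> real" and M L :: real
  assumes continuous: "continuous_on (UNIV \<times> {0..}) (\<lambda>(x, t). w x t)"
    and deriv: "\<And>x t. t \<ge> 0 \<Longrightarrow> ((\<lambda>x. w x t) has_real_derivative w' x t) (at x)"
    and deriv_continuous: "continuous_on (UNIV \<times> {0..}) (\<lambda>(x, t). w' x t)"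
    and bound: "\<And>x t. t \<ge> 0 \<Longrightarrow> \<bar>w x t\<bar> \<le> M"
    and deriv_bound: "\<And>x t. t \<ge> 0 \<Longrightarrow> \<bar>w' x t\<bar> \<le> L"
begin

lemma lipschitz: "t \<ge> 0 \<Longrightarrow> \<bar>w x t - w y t\<bar> \<le> L * \<bar>x - y\<bar>"
  by (rule lipschitz_from_derivative[OF deriv deriv_bound])

lemma M_nonneg: "0 \<le> M"
  using bound[of 0 0] by linarith

lemma L_nonneg: "0 \<le> L"
  using deriv_bound[of 0 0] by linarith

text \<open>Freezing the time argument at 0 for negative s gives integrands continuous on the whole
  line, which then have antiderivatives there.\<close>

lemma continuous_along:
  assumes "continuous_on UNIV X"
  shows "continuous_on UNIV (\<lambda>s. w (X s) (max 0 s))" "continuous_on UNIV (\<lambda>s. w' (X s) (max 0 s))"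
proof -
  have "continuous_on UNIV (\<lambda>s. (X s, max 0 s))" "range (\<lambda>s. (X s, max 0 s)) \<subseteq> UNIV \<times> {0..}"
    using assms by (auto intro!: continuous_intros)
  from continuous_on_compose2[OF continuous this] continuous_on_compose2[OF deriv_continuous this]
  show "continuous_on UNIV (\<lambda>s. w (X s) (max 0 s))" "continuous_on UNIV (\<lambda>s. w' (X s) (max 0 s))"
    by simp_all
qed

text \<open>Picard iteration for \<open>y(t) = exp(-2Kt)(X(t) - \<xi>)\<close>: the weight makes the integral operator a
  contraction on all of \<open>t \<ge> 0\<close> at once.\<close>

lemma characteristic_curve_exists: "\<exists>X. characteristic_curve w \<xi> X"
proof -
  \<comment> \<open>A Lipschitz constant that is at least 1, so that t \<le> exp(2Kt).\<close>
  define K where "K = max 1 L"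
  have K: "K \<ge> 1" "K > 0" by (auto simp: K_def)
  have lipK: "\<bar>w x t - w y t\<bar> \<le> K * \<bar>x - y\<bar>" if "t \<ge> 0" for x y t
  proof -
    have "L * \<bar>x - y\<bar> \<le> K * \<bar>x - y\<bar>" by (intro mult_right_mono) (auto simp: K_def)
    then show ?thesis using lipschitz[OF that, of x y] by linarith
  qed
  \<comment> \<open>The speed along the unweighted curve \<xi> + exp(2Ks) y(s). Its antiderivative
    \<open>F y\<close> is the Picard integral, and \<open>P y\<close> below is that integral with
    the weight restored.\<close>
  define f where "f y s = w (\<xi> + exp (2 * K * max 0 s) * apply_bcontfun y (max 0 s)) (max 0 s)" for y :: "real \<Rightarrow>\<^sub>C real" and s
  have cy: "continuous_on UNIV (\<lambda>s. apply_bcontfun y (max 0 s))" for y :: "real \<Rightarrow>\<^sub>C real"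
    by (rule continuous_on_compose2[OF continuous_on_apply_bcontfun[of UNIV]]) (auto intro!: continuous_intros)
  have cf: "continuous_on UNIV (f y)" for y
    unfolding f_def[abs_def] by (intro continuous_along continuous_intros cy)
  have "\<forall>y. \<exists>F. F 0 = 0 \<and> (\<forall>x. (F has_real_derivative f y x) (at x))"
    using antiderivative_from[OF cf] by metis
  then obtain F where F0: "\<And>y. F y 0 = 0" and F: "\<And>y x. (F y has_real_derivative f y x) (at x)"
    by metis
  have Fw: "(F y has_real_derivative f y x) (at x within {0..})" for y x
    by (rule has_field_derivative_at_within[OF F])
  define P where "P y t = exp (- (2 * K * max 0 t)) * F y (max 0 t)" for y t
  have bc: "P y \<in> bcontfun" for y
  proof -
    \<comment> \<open>The Picard integral grows at most like M t, which the weight exp(-2Kt) reduces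
      to at most M.\<close>
    have "\<bar>P y t\<bar> \<le> M" for t
    proof -
      let ?t = "max 0 t"
      have "\<bar>F y ?t - F y 0\<bar> \<le> M * ?t - M * 0"
        by (rule abs_derivative_comparison[OF _ Fw, where B' = "\<lambda>_. M"])
          (auto intro!: derivative_eq_intros bound simp: f_def)
      moreover have "?t \<le> exp (2 * K * ?t)"
      proof -
        have "?t \<le> 2 * K * ?t" using mult_right_mono[of 1 "2 * K" ?t] K by auto
        also have "\<dots> \<le> exp (2 * K * ?t)" using exp_ge_add_one_self[of "2 * K * ?t"] by linarith
        finally show ?thesis .
      qed
      ultimately have "\<bar>F y ?t\<bar> \<le> M * exp (2 * K * ?t)"
        using mult_left_mono[of ?t "exp (2 * K * ?t)" M] M_nonneg F0 by auto
      then have "exp (- (2 * K * ?t)) * \<bar>F y ?t\<bar> \<le> exp (- (2 * K * ?t)) * (M * exp (2 * K * ?t))"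
        by (intro mult_left_mono) auto
      also have "\<dots> = M"
        by (simp add: exp_minus)
      finally show ?thesis
        by (simp add: P_def abs_mult)
    qed
    moreover have "continuous_on UNIV (P y)"
    proof -
      have "continuous_on UNIV (F y)" by (rule DERIV_continuous_on[OF F])
      then have "continuous_on UNIV (\<lambda>t. F y (max 0 t))"
        by (rule continuous_on_compose2) (auto intro!: continuous_intros)
      then show ?thesis
        unfolding P_def[abs_def] by (intro continuous_intros)
    qed
    ultimately show ?thesis
      unfolding bcontfun_def bounded_iff by auto
  qed
  define T where "T y = Bcontfun (P y)" for y
  have T: "apply_bcontfun (T y) = P y" for y
    using bc by (simp add: T_def Bcontfun_inverse)
  have "dist (T y) (T z) \<le> (1 / 2) * dist y z" for y z
  proof (rule dist_bound)
    fix t :: real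
    let ?t = "max 0 t" and ?d = "dist y z"
    \<comment> \<open>The integral of K exp(2Ks) is half of exp(2Kt) - 1: the 2 in the weight
      becomes the contraction factor 1/2.\<close>
    have "\<bar>(F y ?t - F z ?t) - (F y 0 - F z 0)\<bar> \<le> ?d / 2 * exp (2 * K * ?t) - ?d / 2 * exp (2 * K * 0)"
    proof (rule abs_derivative_comparison[where A' = "\<lambda>s. f y s - f z s" and B' = "\<lambda>s. K * exp (2 * K * s) * ?d"])
      show "((\<lambda>s. F y s - F z s) has_real_derivative f y s - f z s) (at s within {0..})" for s
        by (rule DERIV_diff[OF Fw Fw])
      show "((\<lambda>s. ?d / 2 * exp (2 * K * s)) has_real_derivative K * exp (2 * K * s) * ?d) (at s within {0..})" for s
        by (auto intro!: derivative_eq_intros)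
      show "\<bar>f y s - f z s\<bar> \<le> K * exp (2 * K * s) * ?d" if "s \<ge> 0" for s
      proof -
        have "\<bar>f y s - f z s\<bar> \<le> K * \<bar>exp (2 * K * s) * (apply_bcontfun y s - apply_bcontfun z s)\<bar>"
          using lipK[of s "\<xi> + exp (2 * K * s) * apply_bcontfun y s" "\<xi> + exp (2 * K * s) * apply_bcontfun z s"] that
          by (simp add: f_def right_diff_distrib)
        also have "\<dots> = K * exp (2 * K * s) * dist (apply_bcontfun y s) (apply_bcontfun z s)"
          by (simp add: abs_mult dist_real_def)
        also have "\<dots> \<le> K * exp (2 * K * s) * ?d"
          using K by (intro mult_left_mono dist_bounded) auto
        finally show ?thesis .
      qed
    qed simp
    then have "\<bar>F y ?t - F z ?t\<bar> \<le> ?d / 2 * exp (2 * K * ?t)"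
      using zero_le_dist[of y z] unfolding F0 mult_zero_right exp_zero diff_self diff_0_right by linarith
    then have "exp (- (2 * K * ?t)) * \<bar>F y ?t - F z ?t\<bar> \<le> exp (- (2 * K * ?t)) * (?d / 2 * exp (2 * K * ?t))"
      by (intro mult_left_mono) auto
    also have "\<dots> = (1 / 2) * ?d"
      by (simp add: exp_minus)
    finally show "dist (apply_bcontfun (T y) t) (apply_bcontfun (T z) t) \<le> (1 / 2) * ?d"
      by (simp only: T P_def dist_real_def right_diff_distrib[symmetric] abs_mult abs_exp_cancel)
  qed
  then obtain y where "T y = y"
    using banach_fix_type[of "1 / 2" T] by auto
  then have y: "F y s = exp (2 * K * s) * apply_bcontfun y s" if "s \<ge> 0" for s
    using fun_cong[OF T[of y], of s] that by (simp add: P_def exp_minus field_simps)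
  have "((\<lambda>s. \<xi> + F y s) has_real_derivative w (\<xi> + F y t) t) (at t within {0..})" if "t \<ge> 0" for t
  proof -
    have "f y t = w (\<xi> + F y t) t" using y[OF that] that by (simp add: f_def)
    then show ?thesis using Fw[of y t] by (auto intro!: derivative_eq_intros)
  qed
  then have "characteristic_curve w \<xi> (\<lambda>s. \<xi> + F y s)"
    using F0 by (simp add: characteristic_curve_def)
  then show ?thesis by blast
qed

section \<open>The flow map and its bijectivity\<close>

text \<open>The choice is determined for t \<ge> 0 by uniqueness of characteristics; values at
  negative times are arbitrary.\<close>

definition flow :: "real \<Rightarrow> real \<Rightarrow> real" where
  "flow \<xi> = (SOME X. characteristic_curve w \<xi> X)"

lemma flow: "characteristic_curve w \<xi> (flow \<xi>)"
  unfolding flow_def by (rule someI_ex[OF characteristic_curve_exists])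

lemma flow_0 [simp]: "flow \<xi> 0 = \<xi>"
  using flow by (simp add: characteristic_curve_def)

lemma flow_derivative: "t \<ge> 0 \<Longrightarrow> (flow \<xi> has_real_derivative w (flow \<xi> t) t) (at t within {0..})"
  using flow by (simp add: characteristic_curve_def)

lemma flow_dist:
  assumes "t \<ge> 0"
  shows "\<bar>flow \<xi> t - flow \<eta> t\<bar> \<le> exp (L * t) * \<bar>\<xi> - \<eta>\<bar>"
    and "exp (- L * t) * \<bar>\<xi> - \<eta>\<bar> \<le> \<bar>flow \<xi> t - flow \<eta> t\<bar>"
  using gronwall[of "\<lambda>s. flow \<xi> s - flow \<eta> s" "\<lambda>s. w (flow \<xi> s) s - w (flow \<eta> s) s" L t] assms
  by (auto intro!: DERIV_diff flow_derivative lipschitz)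

lemma flow_displacement:
  assumes "t \<ge> 0"
  shows "\<bar>flow \<xi> t - \<xi>\<bar> \<le> M * t"
proof -
  have "\<bar>flow \<xi> t - flow \<xi> 0\<bar> \<le> M * t - M * 0"
    by (rule abs_derivative_comparison[OF assms flow_derivative, where B' = "\<lambda>_. M"])
      (auto intro!: derivative_eq_intros bound)
  then show ?thesis by simp
qed

lemma flow_continuous: "continuous_on UNIV (\<lambda>s. flow \<xi> (max 0 s))"
proof -
  have "continuous_on {0..} (flow \<xi>)"
    by (rule DERIV_continuous_on[OF flow_derivative]) simp
  then show ?thesis
    by (rule continuous_on_compose2) (auto intro!: continuous_intros)
qed

text \<open>Injectivity is the lower Gronwall bound. Since the flow is continuous in \<xi> and
  displaces points by at most M t, every x is an intermediate value between the images of x - M t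
  and x + M t.\<close>

lemma flow_bij: 
  assumes "t \<ge> 0"
  shows "bij (\<lambda>\<xi>. flow \<xi> t)"
proof (rule bijI)
  show "inj (\<lambda>\<xi>. flow \<xi> t)"
  proof (rule injI)
    fix \<xi> \<eta> assume "flow \<xi> t = flow \<eta> t"
    then show "\<xi> = \<eta>" using flow_dist(2)[OF assms, of \<xi> \<eta>] by (simp add: mult_le_0_iff)
  qed
  have "continuous_on UNIV (\<lambda>\<xi>. flow \<xi> t)"
  proof (rule lipschitz_on_continuous_on)
    show "(exp (L * t))-lipschitz_on UNIV (\<lambda>\<xi>. flow \<xi> t)"
      using flow_dist(1)[OF assms] by (auto intro!: lipschitz_onI simp: dist_real_def)
  qed
  moreover have "flow (x - M * t) t \<le> x" "x \<le> flow (x + M * t) t" for x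
    using flow_displacement[OF assms, of "x - M * t"] flow_displacement[OF assms, of "x + M * t"] by linarith+
  moreover have "x - M * t \<le> x + M * t" for x
    using M_nonneg assms by simp
  ultimately show "surj (\<lambda>\<xi>. flow \<xi> t)"
    unfolding surj_def
    by (metis IVT'[of "\<lambda>\<xi>. flow \<xi> t"] continuous_on_subset subset_UNIV)
qed

section \<open>Differentiability of the flow in its initial point\<close>

text \<open>Uniform continuity of w' on a compact tube around the trajectory. The point z stands for
  a mean value point between two trajectories, which is why it is only constrained by their
  distance.\<close>

lemma deriv_modulus:
  assumes "t \<ge> 0" "\<epsilon> > 0"
  obtains \<delta> where "\<delta> > 0"
    "\<And>\<eta> s z. \<bar>\<eta> - \<xi>\<bar> < \<delta> \<Longrightarrow> 0 \<le> s \<Longrightarrow> s \<le> t \<Longrightarrow> \<bar>z - flow \<xi> s\<bar> \<le> \<bar>flow \<eta> s - flow \<xi> s\<bar> \<Longrightarrow>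
       \<bar>w' z s - w' (flow \<xi> s) s\<bar> < \<epsilon>"
proof -
  let ?C = "{\<xi> - M * t - 1 .. \<xi> + M * t + 1} \<times> {0..t}"
  have "uniformly_continuous_on ?C (\<lambda>(x, t). w' x t)"
    by (rule compact_uniformly_continuous[OF continuous_on_subset[OF deriv_continuous]])
      (auto intro!: compact_Times)
  then obtain d where d: "d > 0"
    "\<And>p q. p \<in> ?C \<Longrightarrow> q \<in> ?C \<Longrightarrow> dist q p < d \<Longrightarrow> dist (case q of (x, t) \<Rightarrow> w' x t) (case p of (x, t) \<Rightarrow> w' x t) < \<epsilon>"
    using \<open>\<epsilon> > 0\<close> unfolding uniformly_continuous_on_def by metis
  \<comment> \<open>Up to time t distances grow by at most exp(L t), so z stays within d of the
    trajectory, and within 1, the margin of the tube.\<close>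
  define \<delta> where "\<delta> = min 1 d / exp (L * t)"
  show thesis
  proof (rule that)
    show "\<delta> > 0" using d by (simp add: \<delta>_def)
    fix \<eta> s z
    assume A: "\<bar>\<eta> - \<xi>\<bar> < \<delta>" "0 \<le> s" "s \<le> t" "\<bar>z - flow \<xi> s\<bar> \<le> \<bar>flow \<eta> s - flow \<xi> s\<bar>"
    have "\<bar>flow \<eta> s - flow \<xi> s\<bar> \<le> exp (L * s) * \<bar>\<eta> - \<xi>\<bar>"
      using A by (intro flow_dist)
    also have "\<dots> \<le> exp (L * t) * \<bar>\<eta> - \<xi>\<bar>"
      using A L_nonneg by (intro mult_right_mono) (auto intro!: mult_left_mono)
    also have "\<dots> < exp (L * t) * \<delta>"
      using A by simp
    finally have z: "\<bar>z - flow \<xi> s\<bar> < min 1 d"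
      using A by (simp add: \<delta>_def)
    have "\<bar>flow \<xi> s - \<xi>\<bar> \<le> M * t"
      using flow_displacement[of s \<xi>] mult_left_mono[OF A(3) M_nonneg] A by linarith
    then have "(flow \<xi> s, s) \<in> ?C" "(z, s) \<in> ?C"
      using z A by auto
    moreover have "dist (z, s) (flow \<xi> s, s) < d"
      using z by (simp add: dist_Pair_Pair dist_real_def)
    ultimately show "\<bar>w' z s - w' (flow \<xi> s) s\<bar> < \<epsilon>"
      using d(2)[of "(flow \<xi> s, s)" "(z, s)"] by (simp add: dist_real_def)
  qed
qed

text \<open>The integral of w' along the trajectory. By the variational equation its exponential
  should be the derivative of the flow in \<xi>.\<close>

definition log_jacobian :: "real \<Rightarrow> real \<Rightarrow> real" where
  "log_jacobian \<xi> = (SOME A. A 0 = 0 \<and>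
     (\<forall>s. (A has_real_derivative w' (flow \<xi> (max 0 s)) (max 0 s)) (at s)))"

lemma log_jacobian:
  "log_jacobian \<xi> 0 = 0" "(log_jacobian \<xi> has_real_derivative w' (flow \<xi> (max 0 s)) (max 0 s)) (at s)"
proof -
  have "\<exists>A. A 0 = 0 \<and> (\<forall>s. (A has_real_derivative w' (flow \<xi> (max 0 s)) (max 0 s)) (at s))"
    using antiderivative_from[OF continuous_along(2)[OF flow_continuous]] by metis
  from someI_ex[OF this]
  show "log_jacobian \<xi> 0 = 0" "(log_jacobian \<xi> has_real_derivative w' (flow \<xi> (max 0 s)) (max 0 s)) (at s)"
    unfolding log_jacobian_def by blast+
qed

lemma log_jacobian_continuous:
  assumes "t \<ge> 0"
  shows "isCont (\<lambda>\<xi>. log_jacobian \<xi> t) \<xi>"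
  unfolding continuous_at_eps_delta
proof (intro allI impI)
  fix e :: real assume e: "e > 0"
  \<comment> \<open>Dividing by t + 1 instead of t covers t = 0 and makes the integrated bound
    strictly less than e.\<close>
  obtain \<delta> where \<delta>: "\<delta> > 0"
    "\<And>\<eta> s z. \<bar>\<eta> - \<xi>\<bar> < \<delta> \<Longrightarrow> 0 \<le> s \<Longrightarrow> s \<le> t \<Longrightarrow> \<bar>z - flow \<xi> s\<bar> \<le> \<bar>flow \<eta> s - flow \<xi> s\<bar> \<Longrightarrow>
       \<bar>w' z s - w' (flow \<xi> s) s\<bar> < e / (t + 1)"
    using deriv_modulus[OF assms, of "e / (t + 1)"] e assms by auto
  have "\<bar>log_jacobian \<eta> t - log_jacobian \<xi> t\<bar> < e" if "\<bar>\<eta> - \<xi>\<bar> < \<delta>" for \<eta>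
  proof -
    have "\<bar>(log_jacobian \<eta> t - log_jacobian \<xi> t) - (log_jacobian \<eta> 0 - log_jacobian \<xi> 0)\<bar>
        \<le> e / (t + 1) * t - e / (t + 1) * 0"
    proof (rule abs_derivative_comparison[OF assms])
      show "((\<lambda>s. log_jacobian \<eta> s - log_jacobian \<xi> s) has_real_derivative
          w' (flow \<eta> (max 0 s)) (max 0 s) - w' (flow \<xi> (max 0 s)) (max 0 s)) (at s within {0..})" for s
        by (rule has_field_derivative_at_within[OF DERIV_diff[OF log_jacobian(2) log_jacobian(2)]])
      show "((\<lambda>s. e / (t + 1) * s) has_real_derivative e / (t + 1)) (at s within {0..})" for s
        using assms by (auto intro!: derivative_eq_intros)
    qed (use \<delta>(2)[OF that] in \<open>auto simp: less_imp_le\<close>)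
    also have "\<dots> < e" using e assms by (simp add: field_simps)
    finally show ?thesis by (simp add: log_jacobian)
  qed
  then show "\<exists>d>0. \<forall>\<eta>. dist \<eta> \<xi> < d \<longrightarrow> dist (log_jacobian \<eta> t) (log_jacobian \<xi> t) < e"
    using \<delta>(1) by (auto simp: dist_real_def)
qed

text \<open>The difference of two trajectories solves the linear equation \<open>D' = q D\<close>, where \<open>q\<close> is a
  difference quotient of \<open>w\<close>.\<close>

lemma flow_difference:
  assumes "t \<ge> 0" "\<eta> \<noteq> \<xi>"
    and le: "\<And>s z. 0 \<le> s \<Longrightarrow> s \<le> t \<Longrightarrow> \<bar>z - flow \<xi> s\<bar> \<le> \<bar>flow \<eta> s - flow \<xi> s\<bar> \<Longrightarrow>
       \<bar>w' z s - w' (flow \<xi> s) s\<bar> \<le> \<epsilon>"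
  obtains Q where "flow \<eta> t - flow \<xi> t = (\<eta> - \<xi>) * exp Q" "\<bar>Q - log_jacobian \<xi> t\<bar> \<le> \<epsilon> * t"
proof -
  define D where "D s = flow \<eta> s - flow \<xi> s" for s
  have D0: "D s \<noteq> 0" if "s \<ge> 0" for s
    using flow_dist(2)[OF that, of \<eta> \<xi>] assms(2) by (auto simp: D_def mult_le_0_iff)
  \<comment> \<open>By the lower Gronwall bound D never vanishes, so the quotient is defined and
    continuous at all times.\<close>
  define q where "q s = (w (flow \<eta> (max 0 s)) (max 0 s) - w (flow \<xi> (max 0 s)) (max 0 s)) / D (max 0 s)" for s
  have "continuous_on UNIV q"
    unfolding q_def D_def
    by (intro continuous_on_divide continuous_on_diff continuous_along flow_continuous)
      (use D0 in \<open>auto simp: D_def\<close>)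
  then obtain Q where Q: "Q 0 = 0" "\<And>s. (Q has_real_derivative q s) (at s)"
    using antiderivative_from by metis
  have D': "(D has_real_derivative q s * D s) (at s within {0..})" if "s \<ge> 0" for s
    using DERIV_diff[OF flow_derivative[OF that, of \<eta>] flow_derivative[OF that, of \<xi>]] that D0[OF that]
    by (simp add: D_def[abs_def] q_def)
  have "\<bar>D t * exp (- Q t) - D 0 * exp (- Q 0)\<bar> \<le> 0 - 0"
  proof (rule abs_derivative_comparison[OF assms(1), where A' = "\<lambda>_. 0" and B = "\<lambda>_. 0" and B' = "\<lambda>_. 0"])
    show "((\<lambda>s. D s * exp (- Q s)) has_real_derivative 0) (at s within {0..})" if "s \<ge> 0" for s
      by (rule derivative_eq_intros D'[OF that] has_field_derivative_at_within[OF Q(2)] refl | simp)+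
  qed auto
  then have "D t = (\<eta> - \<xi>) * exp (Q t)"
    using Q(1) by (simp add: D_def exp_minus field_simps)
  moreover have "\<bar>(Q t - log_jacobian \<xi> t) - (Q 0 - log_jacobian \<xi> 0)\<bar> \<le> \<epsilon> * t - \<epsilon> * 0"
  proof (rule abs_derivative_comparison[OF assms(1)])
    show "((\<lambda>s. Q s - log_jacobian \<xi> s) has_real_derivative q s - w' (flow \<xi> (max 0 s)) (max 0 s)) (at s within {0..})" for s
      by (rule has_field_derivative_at_within[OF DERIV_diff[OF Q(2) log_jacobian(2)]])
    show "((\<lambda>s. \<epsilon> * s) has_real_derivative \<epsilon>) (at s within {0..})" for s
      by (auto intro!: derivative_eq_intros)
    show "\<bar>q s - w' (flow \<xi> (max 0 s)) (max 0 s)\<bar> \<le> \<epsilon>" if "s \<ge> 0" "s \<le> t" for s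
    proof -
      \<comment> \<open>The mean value point lies between the two trajectories, which is where
        \<open>le\<close> controls w'.\<close>
      obtain z where "w (flow \<eta> s) s - w (flow \<xi> s) s = w' z s * D s" "\<bar>z - flow \<xi> s\<bar> \<le> \<bar>D s\<bar>"
      proof (cases "flow \<xi> s < flow \<eta> s")
        case True
        obtain z where "flow \<xi> s < z" "z < flow \<eta> s"
          "w (flow \<eta> s) s - w (flow \<xi> s) s = (flow \<eta> s - flow \<xi> s) * w' z s"
          using MVT2[OF True, of "\<lambda>x. w x s" "\<lambda>x. w' x s"] deriv[OF \<open>s \<ge> 0\<close>] by blast
        then show thesis using that[of z] by (simp add: D_def mult.commute)
      next
        case False
        then have less: "flow \<eta> s < flow \<xi> s" using D0[OF \<open>s \<ge> 0\<close>] by (simp add: D_def)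
        obtain z where "flow \<eta> s < z" "z < flow \<xi> s"
          "w (flow \<xi> s) s - w (flow \<eta> s) s = (flow \<xi> s - flow \<eta> s) * w' z s"
          using MVT2[OF less, of "\<lambda>x. w x s" "\<lambda>x. w' x s"] deriv[OF \<open>s \<ge> 0\<close>] by blast
        then show thesis using that[of z] by (simp add: D_def algebra_simps)
      qed
      then show ?thesis
        using le[OF that, of z] that D0[OF that(1)] by (simp add: q_def D_def)
    qed
  qed
  ultimately show thesis
    using that[of "Q t"] Q(1) by (simp add: D_def log_jacobian)
qed

text \<open>The logarithm of the difference quotient is the Q of \<open>flow_difference\<close>,
  hence within \<epsilon> t of \<open>log_jacobian\<close>. Convergence is proved for logarithms and
  then exponentiated.\<close>

lemma flow_space_derivative:
  assumes t: "t \<ge> 0"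
  shows "((\<lambda>\<xi>. flow \<xi> t) has_real_derivative exp (log_jacobian \<xi> t)) (at \<xi>)"
proof -
  let ?q = "\<lambda>\<eta>. (flow \<eta> t - flow \<xi> t) / (\<eta> - \<xi>)"
  have quot: "?q \<eta> > 0 \<and> \<bar>ln (?q \<eta>) - log_jacobian \<xi> t\<bar> \<le> \<epsilon> * t"
    if ne: "\<eta> \<noteq> \<xi>" and le: "\<And>s z. 0 \<le> s \<Longrightarrow> s \<le> t \<Longrightarrow> \<bar>z - flow \<xi> s\<bar> \<le> \<bar>flow \<eta> s - flow \<xi> s\<bar> \<Longrightarrow>
       \<bar>w' z s - w' (flow \<xi> s) s\<bar> \<le> \<epsilon>" for \<eta> \<epsilon>
  proof -
    obtain Q where "flow \<eta> t - flow \<xi> t = (\<eta> - \<xi>) * exp Q" "\<bar>Q - log_jacobian \<xi> t\<bar> \<le> \<epsilon> * t"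
      using flow_difference[OF t ne le] by blast
    then show ?thesis using ne by simp
  qed
  \<comment> \<open>Only the sign is wanted here, so the crude modulus 2 L suffices, for \<eta> at
    any distance from \<xi>.\<close>
  have pos: "?q \<eta> > 0" if "\<eta> \<noteq> \<xi>" for \<eta>
  proof -
    have "\<bar>w' z s - w' (flow \<xi> s) s\<bar> \<le> 2 * L" if "0 \<le> s" for s z
      using deriv_bound[OF that, of z] deriv_bound[OF that, of "flow \<xi> s"] by linarith
    then show ?thesis using quot[OF that, of "2 * L"] by blast
  qed
  have "((\<lambda>\<eta>. ln (?q \<eta>)) \<longlongrightarrow> log_jacobian \<xi> t) (at \<xi>)"
    unfolding Lim_at
  proof (intro allI impI)
    fix e :: real assume e: "e > 0"
    obtain \<delta> where \<delta>: "\<delta> > 0"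
      "\<And>\<eta> s z. \<bar>\<eta> - \<xi>\<bar> < \<delta> \<Longrightarrow> 0 \<le> s \<Longrightarrow> s \<le> t \<Longrightarrow> \<bar>z - flow \<xi> s\<bar> \<le> \<bar>flow \<eta> s - flow \<xi> s\<bar> \<Longrightarrow>
         \<bar>w' z s - w' (flow \<xi> s) s\<bar> < e / (t + 1)"
      using deriv_modulus[OF t, of "e / (t + 1)"] e t by auto
    have "\<bar>ln (?q \<eta>) - log_jacobian \<xi> t\<bar> < e" if "\<bar>\<eta> - \<xi>\<bar> < \<delta>" "\<eta> \<noteq> \<xi>" for \<eta>
    proof -
      have "\<bar>ln (?q \<eta>) - log_jacobian \<xi> t\<bar> \<le> e / (t + 1) * t"
        using quot[OF that(2), of "e / (t + 1)"] \<delta>(2)[OF that(1)] less_imp_le by blast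
      also have "\<dots> < e" using e t by (simp add: field_simps)
      finally show ?thesis .
    qed
    then show "\<exists>d>0. \<forall>\<eta>. 0 < dist \<eta> \<xi> \<and> dist \<eta> \<xi> < d \<longrightarrow> dist (ln (?q \<eta>)) (log_jacobian \<xi> t) < e"
      using \<delta>(1) by (auto simp: dist_real_def)
  qed
  then have "((\<lambda>\<eta>. exp (ln (?q \<eta>))) \<longlongrightarrow> exp (log_jacobian \<xi> t)) (at \<xi>)"
    by (rule tendsto_exp)
  moreover have "\<forall>\<^sub>F \<eta> in at \<xi>. exp (ln (?q \<eta>)) = ?q \<eta>"
    unfolding eventually_at_filter by (rule always_eventually) (use pos in auto)
  ultimately show ?thesis
    unfolding has_field_derivative_iff by (simp add: tendsto_cong)
qed

text \<open>The derivative of the flow is an exponential and never vanishes, and the inverse is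
  Lipschitz by the lower Gronwall bound; its derivative is continuous because
  \<open>log_jacobian\<close> is.\<close>

lemma flow_inverse_C1:
  assumes t: "t \<ge> 0"
  shows "inv (\<lambda>\<xi>. flow \<xi> t) C1_differentiable_on UNIV"
proof -
  let ?\<phi> = "inv (\<lambda>\<xi>. flow \<xi> t)"
  have inv: "flow (?\<phi> x) t = x" for x
    using surj_f_inv_f[OF bij_is_surj[OF flow_bij[OF t]]] .
  have "\<bar>?\<phi> x - ?\<phi> y\<bar> \<le> exp (L * t) * \<bar>x - y\<bar>" for x y
    using flow_dist(2)[OF t, of "?\<phi> x" "?\<phi> y"] by (simp add: inv exp_minus field_simps)
  then have "(exp (L * t))-lipschitz_on UNIV ?\<phi>"
    by (intro lipschitz_onI) (auto simp: dist_real_def)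
  then have cont: "continuous_on UNIV ?\<phi>"
    by (rule lipschitz_on_continuous_on)
  have "(?\<phi> has_real_derivative inverse (exp (log_jacobian (?\<phi> x) t))) (at x)" for x
    by (rule DERIV_inverse_function[OF flow_space_derivative[OF t], where a = "x - 1" and b = "x + 1"])
      (use inv cont in \<open>auto simp: continuous_on_eq_continuous_at\<close>)
  moreover have "continuous_on UNIV (\<lambda>x. inverse (exp (log_jacobian (?\<phi> x) t)))"
  proof -
    have "continuous_on UNIV (\<lambda>\<xi>. log_jacobian \<xi> t)"
      using log_jacobian_continuous[OF t] by (simp add: continuous_on_eq_continuous_at)
    then have "continuous_on UNIV (\<lambda>x. log_jacobian (?\<phi> x) t)"
      by (rule continuous_on_compose2[OF _ cont]) simp
    then show ?thesis by (intro continuous_intros) auto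
  qed
  ultimately show ?thesis
    unfolding C1_differentiable_on_def
    by (intro exI[of _ "\<lambda>x. inverse (exp (log_jacobian (?\<phi> x) t))"])
      (simp add: has_real_derivative_iff_has_vector_derivative)
qed

lemma transported_flow: "transported w v0 (\<lambda>x t. v0 (inv (\<lambda>\<xi>. flow \<xi> t) x))"
  unfolding transported_def
proof (rule exI[of _ flow], rule exI[of _ "\<lambda>x t. inv (\<lambda>\<xi>. flow \<xi> t) x"], intro conjI allI impI refl)
  fix t x \<xi> :: real assume t: "t \<ge> 0"
  show "inv (\<lambda>\<xi>. flow \<xi> t) (flow \<xi> t) = \<xi>"
    by (rule inv_f_f[OF bij_is_inj[OF flow_bij[OF t]]])
  show "flow (inv (\<lambda>\<xi>. flow \<xi> t) x) t = x"
    by (rule surj_f_inv_f[OF bij_is_surj[OF flow_bij[OF t]]])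
  show "(\<lambda>x. inv (\<lambda>\<xi>. flow \<xi> t) x) C1_differentiable_on UNIV"
    by (rule flow_inverse_C1[OF t])
qed (rule flow)

end

section \<open>Transport of Riemann data\<close>

lemma transported_cong:
  assumes "transported w v0 v"
    and "\<And>x t. t \<ge> 0 \<Longrightarrow> w x t = w' x t" "\<And>x t. t \<ge> 0 \<Longrightarrow> v x t = v' x t"
  shows "transported w' v0 v'"
proof -
  obtain \<Phi> \<phi> where A: "\<And>\<xi>. characteristic_curve w \<xi> (\<Phi> \<xi>)"
    and B: "\<forall>t\<ge>0. (\<forall>\<xi>. \<phi> (\<Phi> \<xi> t) t = \<xi>) \<and> (\<forall>x. \<Phi> (\<phi> x t) t = x) \<and> (\<lambda>x. \<phi> x t) C1_differentiable_on UNIV"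
    and C: "\<forall>t\<ge>0. \<forall>x. v x t = v0 (\<phi> x t)"
    using assms(1) unfolding transported_def by blast
  have "\<forall>\<xi>. characteristic_curve w' \<xi> (\<Phi> \<xi>)"
    using A assms(2) by (blast intro: characteristic_curve_cong)
  moreover have "\<forall>t\<ge>0. \<forall>x. v' x t = v0 (\<phi> x t)"
    using C assms(3) by simp
  ultimately show ?thesis
    using B unfolding transported_def by blast
qed

lemma characteristic_curve_continuous: "characteristic_curve w \<xi> X \<Longrightarrow> continuous_on {0..} X"
  unfolding characteristic_curve_def by (intro DERIV_continuous_on[of _ _ "\<lambda>s. w (X s) s"]) auto

text \<open>Two characteristics that changed order would meet by the intermediate value theorem, and
  \<phi> would return both starting points at the meeting. Hence the order is preserved, and the
  sign of the label \<phi>(x,t) tells on which side of \<Phi>(0,t) the point x lies. The argument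
  applies to the speed of a solution that is still unknown.\<close>

lemma transported_riemann_data:
  assumes "transported w (riemann_data l r) v"
  obtains X where "characteristic_curve w 0 X" "\<And>x t. t \<ge> 0 \<Longrightarrow> v x t = riemann_data l r (x - X t)"
proof -
  obtain \<Phi> \<phi> where \<Phi>: "\<And>\<xi>. characteristic_curve w \<xi> (\<Phi> \<xi>)"
    and inv: "\<And>t \<xi>. t \<ge> 0 \<Longrightarrow> \<phi> (\<Phi> \<xi> t) t = \<xi>" "\<And>t x. t \<ge> 0 \<Longrightarrow> \<Phi> (\<phi> x t) t = x"
    and v: "\<And>t x. t \<ge> 0 \<Longrightarrow> v x t = riemann_data l r (\<phi> x t)"
    using assms unfolding transported_def by blast
  have mono: "\<Phi> \<xi> t < \<Phi> \<eta> t" if less: "\<xi> < \<eta>" "t \<ge> 0" for \<xi> \<eta> t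
  proof (rule ccontr)
    assume "\<not> ?thesis"
    moreover have cont: "continuous_on {0..t} (\<Phi> \<zeta>)" for \<zeta>
      by (rule continuous_on_subset[OF characteristic_curve_continuous[OF \<Phi>]]) auto
    moreover have "\<Phi> \<zeta> 0 = \<zeta>" for \<zeta>
      using \<Phi> by (simp add: characteristic_curve_def)
    ultimately obtain s where "0 \<le> s" "\<Phi> \<eta> s - \<Phi> \<xi> s = 0"
      using IVT2'[of "\<lambda>s. \<Phi> \<eta> s - \<Phi> \<xi> s" t 0 0] less continuous_on_diff[OF cont cont] by auto
    then show False using inv(1)[of s \<xi>] inv(1)[of s \<eta>] that by simp
  qed
  have "\<phi> x t < 0 \<longleftrightarrow> x < \<Phi> 0 t" if "t \<ge> 0" for x t
    using mono[of "\<phi> x t" 0 t] mono[of 0 "\<phi> x t" t] inv(2)[OF that, of x] that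
    by (metis less_asym linorder_neqE_linordered_idom)
  then show thesis
    using that[OF \<Phi>[of 0]] v by (simp add: riemann_data_def)
qed

text \<open>The flow provides one transported step; its jump travels along a characteristic from the
  origin, and uniqueness identifies that curve with X.\<close>

lemma (in scalar_field) transported_riemann_dataI:
  assumes X: "characteristic_curve w 0 X" and v: "\<And>x t. t \<ge> 0 \<Longrightarrow> v x t = riemann_data l r (x - X t)"
  shows "transported w (riemann_data l r) v"
proof -
  let ?v = "\<lambda>x t. riemann_data l r (inv (\<lambda>\<xi>. flow \<xi> t) x)"
  have tr: "transported w (riemann_data l r) ?v"
    by (rule transported_flow)
  obtain Y where Y: "characteristic_curve w 0 Y" "\<And>x t. t \<ge> 0 \<Longrightarrow> ?v x t = riemann_data l r (x - Y t)"
    by (rule transported_riemann_data[OF tr]) blast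
  have "Y t = X t" if "t \<ge> 0" for t
    using characteristic_curve_unique[OF Y(1) X lipschitz that] .
  then show ?thesis
    using Y v by (intro transported_cong[OF tr refl]) auto
qed

text \<open>At a first return to 0 the derivative would again be F(0) > 0, so d would be negative
  just before it, contradicting that the return is the first.\<close>

lemma autonomous_curve_positive:
  assumes d: "characteristic_curve (\<lambda>x t. F x) 0 d" and F: "F 0 > 0" and t: "t > 0"
  shows "d t > 0"
proof (rule ccontr)
  assume neg: "\<not> d t > 0"
  have D: "(d has_real_derivative F (d s)) (at s within {0..})" if "s \<ge> 0" for s
    using d that by (simp add: characteristic_curve_def)
  have d0: "d 0 = 0"
    using d by (simp add: characteristic_curve_def)
  obtain \<delta> where \<delta>: "\<delta> > 0" "\<And>h. h > 0 \<Longrightarrow> h < \<delta> \<Longrightarrow> d 0 < d h"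
    using has_real_derivative_pos_inc_right[OF D[of 0]] F d0 by auto
  define a where "a = min (\<delta> / 2) t"
  have a: "a > 0" "a \<le> t" "d a > 0"
    using \<delta>(1) \<delta>(2)[of a] t d0 by (auto simp: a_def min_def)
  have cont: "continuous_on {a..b} d" for b
    by (rule DERIV_continuous_on[OF DERIV_subset[OF D]]) (use a in auto)
  \<comment> \<open>The bad times are cut off at a, where d is already positive; otherwise time 0
    itself would be the minimum.\<close>
  let ?Z = "{a..t} \<inter> d -` {..0}"
  have "closed ?Z"
    by (rule continuous_closed_preimage[OF cont]) auto
  then have "compact ?Z"
    using compact_Int_closed[of "{a..t}" ?Z] by (simp add: Int_absorb1)
  moreover have "?Z \<noteq> {}"
    using neg a by auto
  ultimately have "\<exists>s\<in>?Z. \<forall>r\<in>?Z. s \<le> r"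
    by (rule compact_attains_inf)
  then obtain s where s: "s \<in> ?Z" "\<And>r. r \<in> ?Z \<Longrightarrow> s \<le> r"
    by blast
  have "a < s"
    using s(1) a by (cases "a = s") auto
  have "d s = 0"
  proof -
    obtain r where "a \<le> r" "r \<le> s" "d r = 0"
      using IVT2'[of d s 0 a] s(1) a cont[of s] by auto
    moreover from this have "s \<le> r" using s by auto
    ultimately show ?thesis by simp
  qed
  then obtain \<epsilon> where \<epsilon>: "\<epsilon> > 0" "\<And>h. h > 0 \<Longrightarrow> s - h \<in> {0..} \<Longrightarrow> h < \<epsilon> \<Longrightarrow> d (s - h) < d s"
    using has_real_derivative_pos_inc_left[OF D[of s]] F s(1) a by auto
  define h where "h = min (\<epsilon> / 2) (s - a)"
  have h: "h > 0" "h < \<epsilon>" "a \<le> s - h"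
    using \<epsilon>(1) \<open>a < s\<close> by (auto simp: h_def)
  then have "d (s - h) < 0"
    using \<epsilon>(2)[of h] a \<open>d s = 0\<close> by simp
  then have "s - h \<in> ?Z"
    using h s(1) by simp
  then show False
    using s(2) h by fastforce
qed

lemma riemann_data_discontinuity:
  assumes "l \<noteq> r"
  shows "{x. \<not> isCont (\<lambda>y. riemann_data l r (y - p)) x} = {p}"
proof -
  let ?f = "\<lambda>y. riemann_data l r (y - p)"
  have "isCont ?f x" if "x \<noteq> p" for x
  proof (cases "x < p")
    case True
    then have "\<forall>\<^sub>F y in nhds x. ?f y = l"
      by (intro eventually_mono[OF eventually_nhds_in_open[of "{..<p}" x]]) (auto simp: riemann_data_def)
    then show ?thesis by (simp add: isCont_cong)
  next
    case False
    then have "\<forall>\<^sub>F y in nhds x. ?f y = r"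
      using that by (intro eventually_mono[OF eventually_nhds_in_open[of "{p<..}" x]]) (auto simp: riemann_data_def)
    then show ?thesis by (simp add: isCont_cong)
  qed
  moreover have "\<not> isCont ?f p"
  proof
    assume "isCont ?f p"
    then have "(?f \<longlongrightarrow> r) (at_left p)"
      by (auto simp: isCont_def riemann_data_def intro: tendsto_within_subset)
    moreover have "\<forall>\<^sub>F y in at_left p. ?f y = l"
      unfolding eventually_at_filter by (auto simp: riemann_data_def)
    then have "(?f \<longlongrightarrow> l) (at_left p)"
      by (rule tendsto_eventually)
    ultimately show False
      using tendsto_unique[OF trivial_limit_at_left_real] assms by blast
  qed
  ultimately show ?thesis by auto
qed

section \<open>The averaged speeds and the coupled jump curves\<close>

text \<open>The weights are 1/2 + (\<gamma>-1)/4 and 1/2 - (\<gamma>-1)/4, from expressing u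
  \<plusminus> a through the invariants; changing the sign of a exchanges them.\<close>

lemma speed_riemann:
  fixes \<gamma> :: real
  assumes g: "integrable lborel g" "(LINT x|lborel. g x) = 1"
    and vp: "\<And>y. vp y t = riemann_data l r (y - p)" and vm: "\<And>y. vm y t = riemann_data l' r' (y - m)"
  shows "speed_plus \<gamma> g vp vm x t =
      (1 + \<gamma>) / 4 * (l + (r - l) * primitive g (x - p)) + (3 - \<gamma>) / 4 * (l' + (r' - l') * primitive g (x - m))"
    and "speed_minus \<gamma> g vp vm x t =
      (3 - \<gamma>) / 4 * (l + (r - l) * primitive g (x - p)) + (1 + \<gamma>) / 4 * (l' + (r' - l') * primitive g (x - m))"
proof -
  let ?P = "\<lambda>y. g (x - y) * riemann_data l r (y - p)" and ?M = "\<lambda>y. g (x - y) * riemann_data l' r' (y - m)"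
  have int: "integrable lborel ?P" "integrable lborel ?M"
    using convolution_riemann(1)[OF g] by auto
  have lin: "(LINT y|lborel. a * ?P y + b * ?M y) = a * (LINT y|lborel. ?P y) + b * (LINT y|lborel. ?M y)" for a b
    using int by simp
  have u: "space_conv g (fluid_velocity vp vm) x t = 1 / 2 * (LINT y|lborel. ?P y) + 1 / 2 * (LINT y|lborel. ?M y)"
    unfolding space_conv_def fluid_velocity_def vp vm lin[symmetric]
    by (intro Bochner_Integration.integral_cong) (auto simp: field_simps)
  have a: "space_conv g (sound_speed \<gamma> vp vm) x t =
      (\<gamma> - 1) / 4 * (LINT y|lborel. ?P y) + - (\<gamma> - 1) / 4 * (LINT y|lborel. ?M y)"
    unfolding space_conv_def sound_speed_def vp vm lin[symmetric]
    by (intro Bochner_Integration.integral_cong) (auto simp: field_simps)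
  show "speed_plus \<gamma> g vp vm x t =
      (1 + \<gamma>) / 4 * (l + (r - l) * primitive g (x - p)) + (3 - \<gamma>) / 4 * (l' + (r' - l') * primitive g (x - m))"
    unfolding speed_plus_def u a convolution_riemann(2)[OF g] by (simp add: field_simps)
  show "speed_minus \<gamma> g vp vm x t =
      (3 - \<gamma>) / 4 * (l + (r - l) * primitive g (x - p)) + (1 + \<gamma>) / 4 * (l' + (r' - l') * primitive g (x - m))"
    unfolding speed_minus_def u a convolution_riemann(2)[OF g] by (simp add: field_simps)
qed

lemma linear_bound:
  fixes a b x y X Y :: real
  assumes "\<bar>x\<bar> \<le> X" "\<bar>y\<bar> \<le> Y"
  shows "\<bar>a * x + b * y\<bar> \<le> \<bar>a\<bar> * X + \<bar>b\<bar> * Y"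
proof -
  have "\<bar>a * x + b * y\<bar> \<le> \<bar>a\<bar> * \<bar>x\<bar> + \<bar>b\<bar> * \<bar>y\<bar>"
    using abs_triangle_ineq[of "a * x" "b * y"] by (simp add: abs_mult)
  also have "\<dots> \<le> \<bar>a\<bar> * X + \<bar>b\<bar> * Y"
    using assms by (intro add_mono mult_left_mono) auto
  finally show ?thesis .
qed

text \<open>G stands for the primitive of the kernel, and \<alpha>, \<beta> for the weights
  (1+\<gamma>)/4 and (3-\<gamma>)/4 of the invariants in the speeds.\<close>

locale smoothed_step_pair =
  fixes G G' :: "real \<Rightarrow> real" and B C :: real
    and l\<^sub>p r\<^sub>p l\<^sub>m r\<^sub>m \<alpha> \<beta> :: real
  assumes G_deriv: "\<And>x. (G has_real_derivative G' x) (at x)"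
    and G'_cont: "continuous_on UNIV G'"
    and G_bound: "\<And>x. \<bar>G x\<bar> \<le> B" and G'_bound: "\<And>x. \<bar>G' x\<bar> \<le> C"
begin

definition Vp :: "real \<Rightarrow> real" where
  "Vp s = l\<^sub>p + (r\<^sub>p - l\<^sub>p) * G s"

definition Vm :: "real \<Rightarrow> real" where
  "Vm s = l\<^sub>m + (r\<^sub>m - l\<^sub>m) * G s"

definition wp :: "(real \<Rightarrow> real) \<Rightarrow> (real \<Rightarrow> real) \<Rightarrow> real \<Rightarrow> real \<Rightarrow> real" where
  "wp p m x t = \<alpha> * Vp (x - p t) + \<beta> * Vm (x - m t)"

definition wm :: "(real \<Rightarrow> real) \<Rightarrow> (real \<Rightarrow> real) \<Rightarrow> real \<Rightarrow> real \<Rightarrow> real" where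
  "wm p m x t = \<beta> * Vp (x - p t) + \<alpha> * Vm (x - m t)"

definition gap_speed :: "real \<Rightarrow> real" where
  "gap_speed d = \<alpha> * Vp 0 + \<beta> * Vm d - (\<beta> * Vp (- d) + \<alpha> * Vm 0)"

text \<open>A fixed-point condition: each curve is a characteristic of a field that is built from
  both curves.\<close>

definition jump_curves :: "(real \<Rightarrow> real) \<Rightarrow> (real \<Rightarrow> real) \<Rightarrow> bool" where
  "jump_curves p m \<longleftrightarrow> characteristic_curve (wp p m) 0 p \<and> characteristic_curve (wm p m) 0 m"

lemma G_cont: "continuous_on S G"
  by (rule DERIV_continuous_on[OF has_field_derivative_at_within[OF G_deriv]])

lemma V_bound: "\<bar>Vp s\<bar> \<le> \<bar>l\<^sub>p\<bar> + \<bar>r\<^sub>p - l\<^sub>p\<bar> * B" "\<bar>Vm s\<bar> \<le> \<bar>l\<^sub>m\<bar> + \<bar>r\<^sub>m - l\<^sub>m\<bar> * B"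
  unfolding Vp_def Vm_def
  by (rule order_trans[OF abs_triangle_ineq], simp add: abs_mult mult_left_mono[OF G_bound])+

lemma V_deriv:
  "(Vp has_real_derivative (r\<^sub>p - l\<^sub>p) * G' s) (at s)" "(Vm has_real_derivative (r\<^sub>m - l\<^sub>m) * G' s) (at s)"
  unfolding Vp_def[abs_def] Vm_def[abs_def] by (auto intro!: derivative_eq_intros G_deriv)

lemma V_cont: "continuous_on S Vp" "continuous_on S Vm"
  unfolding Vp_def[abs_def] Vm_def[abs_def] by (intro continuous_intros G_cont)+

text \<open>The coefficients are left general so that one proof covers both fields, in which
  \<alpha> and \<beta> are interchanged.\<close>

lemma scalar_field_shifts:
  assumes p: "continuous_on {0..} p" and m: "continuous_on {0..} m"
  obtains w' M L where "scalar_field (\<lambda>x t. a * Vp (x - p t) + b * Vm (x - m t)) w' M L"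
proof
  have shift: "continuous_on (UNIV \<times> {0..}) (\<lambda>z. fst z - f (snd z))"
    if "continuous_on {0..} f" for f :: "real \<Rightarrow> real"
    by (intro continuous_intros continuous_on_compose2[OF that]) auto
  note comp = continuous_on_compose2[OF _ shift[OF p]] continuous_on_compose2[OF _ shift[OF m]]
  show "scalar_field (\<lambda>x t. a * Vp (x - p t) + b * Vm (x - m t))
      (\<lambda>x t. a * (r\<^sub>p - l\<^sub>p) * G' (x - p t) + b * (r\<^sub>m - l\<^sub>m) * G' (x - m t))
      (\<bar>a\<bar> * (\<bar>l\<^sub>p\<bar> + \<bar>r\<^sub>p - l\<^sub>p\<bar> * B) + \<bar>b\<bar> * (\<bar>l\<^sub>m\<bar> + \<bar>r\<^sub>m - l\<^sub>m\<bar> * B))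
      (\<bar>a * (r\<^sub>p - l\<^sub>p)\<bar> * C + \<bar>b * (r\<^sub>m - l\<^sub>m)\<bar> * C)"
  proof
    show "continuous_on (UNIV \<times> {0..}) (\<lambda>(x, t). a * Vp (x - p t) + b * Vm (x - m t))"
      unfolding split_beta
      by (intro continuous_intros comp(1)[OF V_cont(1)[of UNIV]] comp(2)[OF V_cont(2)[of UNIV]]) auto
    show "continuous_on (UNIV \<times> {0..}) (\<lambda>(x, t). a * (r\<^sub>p - l\<^sub>p) * G' (x - p t) + b * (r\<^sub>m - l\<^sub>m) * G' (x - m t))"
      unfolding split_beta
      by (intro continuous_intros comp(1)[OF G'_cont] comp(2)[OF G'_cont]) auto
    show "((\<lambda>x. a * Vp (x - p t) + b * Vm (x - m t)) has_real_derivative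
        a * (r\<^sub>p - l\<^sub>p) * G' (x - p t) + b * (r\<^sub>m - l\<^sub>m) * G' (x - m t)) (at x)" for x t
      by (auto intro!: derivative_eq_intros DERIV_chain'[OF _ V_deriv(1)] DERIV_chain'[OF _ V_deriv(2)])
  qed (rule linear_bound V_bound G'_bound)+
qed

lemma scalar_field_gap:
  obtains w' M L where "scalar_field (\<lambda>x t. gap_speed x) w' M L"
proof
  have c: "continuous_on UNIV (\<lambda>x. h (- x))" if "continuous_on UNIV h" for h :: "real \<Rightarrow> real"
    by (rule continuous_on_compose2[OF that]) (auto intro!: continuous_intros)
  have D: "(gap_speed has_real_derivative \<beta> * (r\<^sub>m - l\<^sub>m) * G' x + \<beta> * (r\<^sub>p - l\<^sub>p) * G' (- x)) (at x)" for x
    unfolding gap_speed_def[abs_def]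
    by (auto intro!: derivative_eq_intros V_deriv DERIV_chain'[OF _ V_deriv(1)])
  let ?P = "\<bar>l\<^sub>p\<bar> + \<bar>r\<^sub>p - l\<^sub>p\<bar> * B" and ?M = "\<bar>l\<^sub>m\<bar> + \<bar>r\<^sub>m - l\<^sub>m\<bar> * B"
  show "scalar_field (\<lambda>x t. gap_speed x)
      (\<lambda>x t. \<beta> * (r\<^sub>m - l\<^sub>m) * G' x + \<beta> * (r\<^sub>p - l\<^sub>p) * G' (- x))
      ((\<bar>\<alpha>\<bar> * ?P + \<bar>\<beta>\<bar> * ?M) + (\<bar>\<beta>\<bar> * ?P + \<bar>\<alpha>\<bar> * ?M))
      (\<bar>\<beta> * (r\<^sub>m - l\<^sub>m)\<bar> * C + \<bar>\<beta> * (r\<^sub>p - l\<^sub>p)\<bar> * C)"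
  proof
    show "continuous_on (UNIV \<times> {0..}) (\<lambda>(x, t::real). gap_speed x)"
      unfolding split_beta
      by (rule continuous_on_compose2[OF DERIV_continuous_on[OF D]]) (auto intro!: continuous_intros)
    have "continuous_on UNIV (\<lambda>x. \<beta> * (r\<^sub>m - l\<^sub>m) * G' x + \<beta> * (r\<^sub>p - l\<^sub>p) * G' (- x))"
      by (intro continuous_intros G'_cont c)
    then show "continuous_on (UNIV \<times> {0..}) (\<lambda>(x, t::real). \<beta> * (r\<^sub>m - l\<^sub>m) * G' x + \<beta> * (r\<^sub>p - l\<^sub>p) * G' (- x))"
      unfolding split_beta
      by (rule continuous_on_compose2) (auto intro!: continuous_intros)
    show "\<bar>gap_speed x\<bar> \<le> (\<bar>\<alpha>\<bar> * ?P + \<bar>\<beta>\<bar> * ?M) + (\<bar>\<beta>\<bar> * ?P + \<bar>\<alpha>\<bar> * ?M)" for x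
      unfolding gap_speed_def
      by (rule order_trans[OF abs_triangle_ineq4]) (intro add_mono linear_bound V_bound)
  qed (rule D linear_bound G'_bound)+
qed

text \<open>The coupling is undone by solving for the gap d first. The speed of m is then a known
  function of time, and p is recovered as m + d.\<close>

lemma jump_curves_exist: "\<exists>p m. jump_curves p m"
proof -
  obtain d where d: "characteristic_curve (\<lambda>x t. gap_speed x) 0 d"
    using scalar_field_gap scalar_field.characteristic_curve_exists by metis
  have dc: "continuous_on {0..} d" by (rule characteristic_curve_continuous[OF d])
  define drift where "drift t = \<beta> * Vp (- d t) + \<alpha> * Vm 0" for t
  \<comment> \<open>Integration in time is treated as a field without dependence on x, so the
    existence theorem for characteristics applies again.\<close>
  have "scalar_field (\<lambda>x t. drift t) (\<lambda>x t. 0)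
      (\<bar>\<beta>\<bar> * (\<bar>l\<^sub>p\<bar> + \<bar>r\<^sub>p - l\<^sub>p\<bar> * B) + \<bar>\<alpha>\<bar> * (\<bar>l\<^sub>m\<bar> + \<bar>r\<^sub>m - l\<^sub>m\<bar> * B)) 0"
  proof
    have "continuous_on {0..} drift"
      unfolding drift_def[abs_def]
      by (intro continuous_intros continuous_on_compose2[OF V_cont(1)[of UNIV]] dc) auto
    then show "continuous_on (UNIV \<times> {0..}) (\<lambda>(x::real, t). drift t)"
      unfolding split_beta
      by (rule continuous_on_compose2) (auto intro!: continuous_intros)
    show "\<bar>drift t\<bar> \<le> \<bar>\<beta>\<bar> * (\<bar>l\<^sub>p\<bar> + \<bar>r\<^sub>p - l\<^sub>p\<bar> * B) + \<bar>\<alpha>\<bar> * (\<bar>l\<^sub>m\<bar> + \<bar>r\<^sub>m - l\<^sub>m\<bar> * B)" for t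
      unfolding drift_def by (intro linear_bound V_bound)
  qed (auto simp: split_beta)
  then obtain m where m: "characteristic_curve (\<lambda>x t. drift t) 0 m"
    using scalar_field.characteristic_curve_exists by metis
  define p where "p t = m t + d t" for t
  have "wp p m (p t) t = drift t + gap_speed (d t)" "wm p m (m t) t = drift t" for t
    by (simp_all add: wp_def wm_def p_def drift_def gap_speed_def)
  then have "jump_curves p m"
    using m d unfolding jump_curves_def characteristic_curve_def
    by (auto simp: p_def[abs_def] intro!: DERIV_add)
  then show ?thesis by blast
qed

lemma jump_curves_gap:
  assumes "jump_curves p m"
  shows "characteristic_curve (\<lambda>x t. gap_speed x) 0 (\<lambda>t. p t - m t)"
proof -
  have "wp p m (p t) t - wm p m (m t) t = gap_speed (p t - m t)" for t
    by (simp add: wp_def wm_def gap_speed_def)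
  moreover have "((\<lambda>t. p t - m t) has_real_derivative wp p m (p t) t - wm p m (m t) t) (at t within {0..})"
    if "t \<ge> 0" for t
    using assms that by (auto simp: jump_curves_def characteristic_curve_def intro!: DERIV_diff)
  ultimately show ?thesis
    using assms by (simp add: jump_curves_def characteristic_curve_def)
qed

lemma jump_curves_unique:
  assumes A: "jump_curves p m" and B: "jump_curves q n" and t: "t \<ge> 0"
  shows "p t = q t" "m t = n t"
proof -
  obtain w' M L where "scalar_field (\<lambda>x t. gap_speed x) w' M L"
    by (rule scalar_field_gap)
  then interpret scalar_field "\<lambda>x t. gap_speed x" w' M L .
  have gap: "p s - m s = q s - n s" if "s \<ge> 0" for s
    by (rule characteristic_curve_unique[OF jump_curves_gap[OF A] jump_curves_gap[OF B] lipschitz that])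
  \<comment> \<open>Since the gaps agree, m and n have the same speed, independent of x; uniqueness
    then holds with Lipschitz constant 0.\<close>
  let ?f = "\<lambda>x s. \<beta> * Vp (- (p s - m s)) + \<alpha> * Vm 0"
  have "characteristic_curve ?f 0 m"
    using A by (simp add: jump_curves_def characteristic_curve_def wm_def)
  moreover have "characteristic_curve ?f 0 n"
  proof -
    have "n s - q s = m s - p s" if "s \<ge> 0" for s
      using gap[OF that] by simp
    then show ?thesis
      using B by (simp add: jump_curves_def characteristic_curve_def wm_def)
  qed
  ultimately show "m t = n t"
    by (rule characteristic_curve_unique[where L = 0]) (use t in auto)
  then show "p t = q t"
    using gap[OF t] by simp
qed

lemma jump_curves_ordered:
  assumes "jump_curves p m" "gap_speed 0 > 0" "t > 0"
  shows "m t < p t"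
  using autonomous_curve_positive[OF jump_curves_gap[OF assms(1)] assms(2,3)] by simp

end

lemma (in smoothed_step_pair) jump_curve_fields:
  assumes "jump_curves p m"
  obtains w1 M1 L1 w2 M2 L2 where "scalar_field (wp p m) w1 M1 L1" "scalar_field (wm p m) w2 M2 L2"
proof -
  have c: "continuous_on {0..} p" "continuous_on {0..} m"
    using assms characteristic_curve_continuous by (auto simp: jump_curves_def)
  obtain w1 M1 L1 where 1: "scalar_field (wp p m) w1 M1 L1"
    using scalar_field_shifts[OF c, of \<alpha> \<beta>] unfolding wp_def[abs_def] by blast
  obtain w2 M2 L2 where 2: "scalar_field (wm p m) w2 M2 L2"
    using scalar_field_shifts[OF c, of \<beta> \<alpha>] unfolding wm_def[abs_def] by blast
  show thesis
    by (rule that[OF 1 2])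
qed

lemma riemann_data_measurable: "riemann_data l r \<in> borel_measurable borel"
  unfolding riemann_data_def[abs_def] by measurable

lemma bounded_range_riemann_data: "bounded (range (riemann_data l r))"
  by (rule bounded_subset[of "{l, r}"]) (auto simp: riemann_data_def)

section \<open>Existence, uniqueness and the explicit form of the solution\<close>

theorem mainTheorem4:
  fixes g u0 a0 vp0 vm0 :: "real \<Rightarrow> real"
    and \<gamma> ul ur al ar um am vpl vpr vml vmr :: real
  assumes gamma: "\<gamma> > 0" "\<gamma> \<noteq> 1"
    and kernel: "sobolev_W11 g" "\<And>x. g (- x) = g x" "(LINT x|lborel. g x) = 1"
    and sound: "al > 0" "ar > 0"
    and initial: "u0 = riemann_data ul ur" "a0 = riemann_data al ar"
    and initial_inv: "\<And>x. vp0 x = inv_plus \<gamma> (u0 x) (a0 x)" "\<And>x. vm0 x = inv_minus \<gamma> (u0 x) (a0 x)"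
    and left: "vpl = inv_plus \<gamma> ul al" "vml = inv_minus \<gamma> ul al"
    and right: "vpr = inv_plus \<gamma> ur ar" "vmr = inv_minus \<gamma> ur ar"
    and middle: "um = (vpl + vmr) / 2" "am = (\<gamma> - 1) / 2 * ((vpl - vmr) / 2)"
  shows
    \<comment> \<open>the initial value problem has a solution, unique for \<open>t \<ge> 0\<close>\<close>
    "(\<exists>vp vm. averaged_solution \<gamma> g vp0 vm0 vp vm) \<and>
     (\<forall>vp vm wp wm. averaged_solution \<gamma> g vp0 vm0 vp vm \<and> averaged_solution \<gamma> g vp0 vm0 wp wm \<longrightarrow>
        (\<forall>t\<ge>0. \<forall>x. vp x t = wp x t \<and> vm x t = wm x t)) \<and>
     (\<forall>vp vm. averaged_solution \<gamma> g vp0 vm0 vp vm \<longrightarrow>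
        (\<exists>xp xm. characteristic_curve (speed_plus \<gamma> g vp vm) 0 xp \<and>
                 characteristic_curve (speed_minus \<gamma> g vp vm) 0 xm) \<and>
        (\<forall>xp xm. characteristic_curve (speed_plus \<gamma> g vp vm) 0 xp \<and>
                 characteristic_curve (speed_minus \<gamma> g vp vm) 0 xm \<longrightarrow>
           (\<forall>t>0.
              \<comment> \<open>\<open>xp t\<close> and \<open>xm t\<close> are the locations of the discontinuities\<close>
              (vpl \<noteq> vpr \<longrightarrow> {x. \<not> isCont (\<lambda>y. vp y t) x} = {xp t}) \<and>
              (vml \<noteq> vmr \<longrightarrow> {x. \<not> isCont (\<lambda>y. vm y t) x} = {xm t}) \<and>
              xm t < xp t \<and>
              (\<forall>x. vp x t = (if x < xp t then vpl else vpr) \<and>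
                   vm x t = (if x < xm t then vml else vmr) \<and>
                   fluid_velocity vp vm x t =
                     (if x < xm t then ul else if x < xp t then um else ur) \<and>
                   sound_speed \<gamma> vp vm x t =
                     (if x < xm t then al else if x < xp t then am else ar)))))"
proof -
  have g: "integrable lborel g"
    using kernel(1) by (simp add: sobolev_W11_def)
  obtain g' C where g': "\<And>x. (primitive g has_real_derivative g' x) (at x)"
    "continuous_on UNIV g'" "\<And>x. \<bar>g' x\<bar> \<le> C"
    using primitive_C1[OF kernel(1)] by blast
  interpret smoothed_step_pair "primitive g" g' "LINT z|lborel. \<bar>g z\<bar>" C vpl vpr vml vmr
    "(1 + \<gamma>) / 4" "(3 - \<gamma>) / 4"
    by standard (rule g' abs_primitive_le[OF g])+
  have \<gamma>1: "\<gamma> - 1 \<noteq> 0"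
    using gamma by simp
  have v0: "vp0 = riemann_data vpl vpr" "vm0 = riemann_data vml vmr"
    using initial initial_inv left right by (auto simp: riemann_data_def fun_eq_iff)
  have half: "primitive g 0 = 1 / 2"
    using primitive_even[OF g kernel(2)] kernel(3) by simp
  \<comment> \<open>At d = 0 the gap speed is (\<alpha> - \<beta>)(Vp 0 - Vm 0), with \<alpha> -
    \<beta> = (\<gamma>-1)/2; by G(0) = 1/2 both values are arithmetic means of the two
    states.\<close>
  have "gap_speed 0 = (\<gamma> - 1) / 2 * ((vpl + vpr) / 2 - (vml + vmr) / 2)"
    by (simp add: gap_speed_def Vp_def Vm_def half field_simps)
  also have "(vpl + vpr) / 2 - (vml + vmr) / 2 = 2 * (al + ar) / (\<gamma> - 1)"
  proof -
    have "(ul + a + (ur + b)) / 2 - (ul - a + (ur - b)) / 2 = a + b" for a b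
      by (simp add: field_simps)
    then have "(vpl + vpr) / 2 - (vml + vmr) / 2 = 2 * al / (\<gamma> - 1) + 2 * ar / (\<gamma> - 1)"
      unfolding left right inv_plus_def inv_minus_def .
    then show ?thesis
      by (simp add: add_divide_distrib)
  qed
  also have "(\<gamma> - 1) / 2 * (2 * (al + ar) / (\<gamma> - 1)) = al + ar"
    using \<gamma>1 by (simp add: field_simps)
  finally have gap0: "gap_speed 0 > 0"
    using sound by simp
  have speeds: "speed_plus \<gamma> g vp vm x t = wp p m x t" "speed_minus \<gamma> g vp vm x t = wm p m x t"
    if "\<And>y. vp y t = riemann_data vpl vpr (y - p t)" "\<And>y. vm y t = riemann_data vml vmr (y - m t)"
    for vp vm p m x t
    using speed_riemann[of g vp t vpl vpr "p t" vm vml vmr "m t" \<gamma> x] g kernel(3) that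
    by (simp_all add: wp_def wm_def Vp_def Vm_def)
  \<comment> \<open>Every solution is reduced to a pair of jump curves; uniqueness and the explicit
    form are both read off from this.\<close>
  have struct: "\<exists>p m. jump_curves p m \<and> (\<forall>t\<ge>0. \<forall>x.
      vp x t = riemann_data vpl vpr (x - p t) \<and> vm x t = riemann_data vml vmr (x - m t) \<and>
      speed_plus \<gamma> g vp vm x t = wp p m x t \<and> speed_minus \<gamma> g vp vm x t = wm p m x t)"
    if "averaged_solution \<gamma> g vp0 vm0 vp vm" for vp vm
  proof -
    have tr: "transported (speed_plus \<gamma> g vp vm) (riemann_data vpl vpr) vp"
      "transported (speed_minus \<gamma> g vp vm) (riemann_data vml vmr) vm"
      using that by (simp_all add: averaged_solution_def v0)
    obtain p where p: "characteristic_curve (speed_plus \<gamma> g vp vm) 0 p"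
      "\<And>x t. t \<ge> 0 \<Longrightarrow> vp x t = riemann_data vpl vpr (x - p t)"
      by (rule transported_riemann_data[OF tr(1)]) blast
    obtain m where m: "characteristic_curve (speed_minus \<gamma> g vp vm) 0 m"
      "\<And>x t. t \<ge> 0 \<Longrightarrow> vm x t = riemann_data vml vmr (x - m t)"
      by (rule transported_riemann_data[OF tr(2)]) blast
    have sp: "speed_plus \<gamma> g vp vm x t = wp p m x t" "speed_minus \<gamma> g vp vm x t = wm p m x t"
      if "t \<ge> 0" for x t
      using speeds[of vp t p vm m x] p(2) m(2) that by auto
    have "jump_curves p m"
      using characteristic_curve_cong[OF p(1) sp(1)] characteristic_curve_cong[OF m(1) sp(2)]
      by (simp add: jump_curves_def)
    then show ?thesis
      using p(2) m(2) sp by blast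
  qed

  have existence: "\<exists>vp vm. averaged_solution \<gamma> g vp0 vm0 vp vm"
  proof -
    obtain p m where pm: "jump_curves p m"
      using jump_curves_exist by blast
    obtain w1 M1 L1 w2 M2 L2 where f: "scalar_field (wp p m) w1 M1 L1" "scalar_field (wm p m) w2 M2 L2"
      using jump_curve_fields[OF pm] by blast
    let ?vp = "\<lambda>x t. riemann_data vpl vpr (x - p t)" and ?vm = "\<lambda>x t. riemann_data vml vmr (x - m t)"
    \<comment> \<open>Self-consistency: the steps placed along p and m generate exactly the fields
      for which p and m are characteristics.\<close>
    have "speed_plus \<gamma> g ?vp ?vm = wp p m" "speed_minus \<gamma> g ?vp ?vm = wm p m"
      using speeds[of ?vp _ p ?vm m] by (auto simp: fun_eq_iff)
    moreover have "transported (wp p m) (riemann_data vpl vpr) ?vp"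
      using scalar_field.transported_riemann_dataI[OF f(1)] pm by (auto simp: jump_curves_def)
    moreover have "transported (wm p m) (riemann_data vml vmr) ?vm"
      using scalar_field.transported_riemann_dataI[OF f(2)] pm by (auto simp: jump_curves_def)
    ultimately have "averaged_solution \<gamma> g vp0 vm0 ?vp ?vm"
      by (simp add: averaged_solution_def v0 riemann_data_measurable bounded_range_riemann_data)
    then show ?thesis by blast
  qed

  have uniqueness: "vp x t = wp' x t \<and> vm x t = wm' x t"
    if A: "averaged_solution \<gamma> g vp0 vm0 vp vm" and B: "averaged_solution \<gamma> g vp0 vm0 wp' wm'" and t: "t \<ge> 0"
    for vp vm wp' wm' x t
  proof -
    obtain p m where 1: "jump_curves p m" "vp x t = riemann_data vpl vpr (x - p t)" "vm x t = riemann_data vml vmr (x - m t)"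
      using struct[OF A] t by blast
    obtain q n where 2: "jump_curves q n" "wp' x t = riemann_data vpl vpr (x - q t)" "wm' x t = riemann_data vml vmr (x - n t)"
      using struct[OF B] t by blast
    show ?thesis
      using jump_curves_unique[OF 1(1) 2(1) t] 1 2 by simp
  qed

  have form: "(\<exists>xp xm. characteristic_curve (speed_plus \<gamma> g vp vm) 0 xp \<and>
                 characteristic_curve (speed_minus \<gamma> g vp vm) 0 xm) \<and>
        (\<forall>xp xm. characteristic_curve (speed_plus \<gamma> g vp vm) 0 xp \<and>
                 characteristic_curve (speed_minus \<gamma> g vp vm) 0 xm \<longrightarrow>
           (\<forall>t>0.
              (vpl \<noteq> vpr \<longrightarrow> {x. \<not> isCont (\<lambda>y. vp y t) x} = {xp t}) \<and>
              (vml \<noteq> vmr \<longrightarrow> {x. \<not> isCont (\<lambda>y. vm y t) x} = {xm t}) \<and>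
              xm t < xp t \<and>
              (\<forall>x. vp x t = (if x < xp t then vpl else vpr) \<and>
                   vm x t = (if x < xm t then vml else vmr) \<and>
                   fluid_velocity vp vm x t =
                     (if x < xm t then ul else if x < xp t then um else ur) \<and>
                   sound_speed \<gamma> vp vm x t =
                     (if x < xm t then al else if x < xp t then am else ar))))"
    if sol: "averaged_solution \<gamma> g vp0 vm0 vp vm" for vp vm
  proof -
    obtain p m where pm: "jump_curves p m"
      and v: "\<And>t x. t \<ge> 0 \<Longrightarrow> vp x t = riemann_data vpl vpr (x - p t)"
        "\<And>t x. t \<ge> 0 \<Longrightarrow> vm x t = riemann_data vml vmr (x - m t)"
      and sp: "\<And>x t. t \<ge> 0 \<Longrightarrow> speed_plus \<gamma> g vp vm x t = wp p m x t"
        "\<And>x t. t \<ge> 0 \<Longrightarrow> speed_minus \<gamma> g vp vm x t = wm p m x t"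
      using struct[OF sol] by blast
    obtain w1 M1 L1 w2 M2 L2 where f: "scalar_field (wp p m) w1 M1 L1" "scalar_field (wm p m) w2 M2 L2"
      using jump_curve_fields[OF pm] by blast
    have pm': "characteristic_curve (wp p m) 0 p" "characteristic_curve (wm p m) 0 m"
      using pm by (simp_all add: jump_curves_def)
    have ex: "characteristic_curve (speed_plus \<gamma> g vp vm) 0 p" "characteristic_curve (speed_minus \<gamma> g vp vm) 0 m"
      using characteristic_curve_cong[OF pm'(1)] characteristic_curve_cong[OF pm'(2)] sp by simp_all
    \<comment> \<open>The speeds are now known to be Lipschitz in x, so any characteristics from the
      origin coincide with p and m.\<close>
    have uq: "xp t = p t" "xm t = m t"
      if "characteristic_curve (speed_plus \<gamma> g vp vm) 0 xp" "characteristic_curve (speed_minus \<gamma> g vp vm) 0 xm" "t \<ge> 0"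
      for xp xm t
      using characteristic_curve_unique[OF characteristic_curve_cong[OF that(1) sp(1)] pm'(1)
          scalar_field.lipschitz[OF f(1)] that(3)]
        characteristic_curve_unique[OF characteristic_curve_cong[OF that(2) sp(2)] pm'(2)
          scalar_field.lipschitz[OF f(2)] that(3)] by simp_all
    have main: "(vpl \<noteq> vpr \<longrightarrow> {x. \<not> isCont (\<lambda>y. vp y t) x} = {p t}) \<and>
              (vml \<noteq> vmr \<longrightarrow> {x. \<not> isCont (\<lambda>y. vm y t) x} = {m t}) \<and>
              m t < p t \<and>
              (\<forall>x. vp x t = (if x < p t then vpl else vpr) \<and>
                   vm x t = (if x < m t then vml else vmr) \<and>
                   fluid_velocity vp vm x t =
                     (if x < m t then ul else if x < p t then um else ur) \<and>
                   sound_speed \<gamma> vp vm x t =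
                     (if x < m t then al else if x < p t then am else ar))"
      if t: "t > 0" for t
    proof -
      have less: "m t < p t"
        by (rule jump_curves_ordered[OF pm gap0 t])
      have vt: "vp x t = (if x < p t then vpl else vpr)" "vm x t = (if x < m t then vml else vmr)" for x
        using v[of t x] t by (simp_all add: riemann_data_def)
      have ul: "(vpl + vml) / 2 = ul" "(vpr + vmr) / 2 = ur"
        by (simp_all add: left right inv_plus_def inv_minus_def)
      have al: "(\<gamma> - 1) / 4 * (vpl - vml) = al" "(\<gamma> - 1) / 4 * (vpr - vmr) = ar"
      proof -
        have "(\<gamma> - 1) / 4 * (u + 2 * a / (\<gamma> - 1) - (u - 2 * a / (\<gamma> - 1))) = a" for u a
        proof -
          have "u + 2 * a / (\<gamma> - 1) - (u - 2 * a / (\<gamma> - 1)) = 4 * a / (\<gamma> - 1)"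
            by simp
          then show ?thesis using \<gamma>1 by simp
        qed
        then show "(\<gamma> - 1) / 4 * (vpl - vml) = al" "(\<gamma> - 1) / 4 * (vpr - vmr) = ar"
          unfolding left right inv_plus_def inv_minus_def by this+
      qed
      \<comment> \<open>The ordering \<open>less\<close> excludes the combination of
        \<open>vpr\<close> with \<open>vml\<close>; between the jumps the states \<open>vpl\<close>
        and \<open>vmr\<close> meet, which are those defining \<open>um\<close> and
        \<open>am\<close>.\<close>
      have "fluid_velocity vp vm x t = (if x < m t then ul else if x < p t then um else ur)" for x
        using less ul by (simp add: fluid_velocity_def vt middle)
      moreover have "sound_speed \<gamma> vp vm x t = (if x < m t then al else if x < p t then am else ar)" for x
        using less al by (simp add: sound_speed_def vt middle)
      moreover have "(\<lambda>y. vp y t) = (\<lambda>y. riemann_data vpl vpr (y - p t))"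
        "(\<lambda>y. vm y t) = (\<lambda>y. riemann_data vml vmr (y - m t))"
        using v t by (auto simp: fun_eq_iff)
      ultimately show ?thesis
        using less vt riemann_data_discontinuity by auto
    qed
    show ?thesis
    proof (rule conjI, goal_cases)
      case 1
      then show ?case using ex by blast
    next
      case 2
      show ?case
      proof (intro allI impI, goal_cases)
        case (1 xp xm t)
        then have eq: "xp t = p t" "xm t = m t"
          using uq[of xp xm t] by auto
        show ?case
          unfolding eq by (rule main[OF \<open>t > 0\<close>])
      qed
    qed
  qed
  show ?thesis
    using existence uniqueness form by blast
qed

end
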